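(* Let $b$ be a positive odd integer. Suppose that $G$ is a connected graph of even order $n\geq F(b,\delta)$ with minimum degree $\delta$, where $F(b,\delta)=\max\{4(b+1)\delta+4,\; b\delta^3+\delta\}$. If $\rho(G)\geq\rho(T(n,b,\delta))$, where $T(n,b,\delta)=K_{\delta}\nabla\big(K_{n-(b+1)\delta-1}\cup (b\delta+1)K_{1}\big)$, then $G$ contains an odd $[1,b]$-factor, unless $G\cong T(n,b,\delta)$.
   Context: All graphs are finite, simple and undirected. The order of a graph is its number of vertices. For a graph $G$ with adjacency matrix $A(G)$, the spectral radius $\rho(G)$ is the largest eigenvalue of $A(G)$. $K_m$ is the complete graph on $m$ vertices, $mK_1$ is the graph with $m$ vertices and no edges, $\cup$ denotes the disjoint union of graphs, and $G_1\nabla G_2$ denotes the join, obtained from the disjoint union of $G_1$ and $G_2$ by adding all edges between $V(G_1)$ and $V(G_2)$. An odd $[1,b]$-factor of a graph $G$ is a spanning subgraph $H$ of $G$ such that $d_H(v)$ is odd and $1\leq d_H(v)\leq b$ for each $v\in V(G)$, where $d_H(v)$ is the degree of $v$ in $H$. *)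

theory Defs
  imports
    "HOL-Library.Countable_Set"
    "Graph_Theory.Graph_Theory"
    "Jordan_Normal_Form.Spectral_Radius"
begin

text \<open>
  A finite simple undirected graph is a \<^locale>\<open>pair_graph\<close>: a finite, loop-free, symmetric
  digraph without parallel arcs. An undirected edge is the pair of arcs \<open>(u, v)\<close>, \<open>(v, u)\<close>,
  so the degree of a vertex is its out-degree.
\<close>

abbreviation degree_of :: "'a pair_pre_digraph \<Rightarrow> 'a \<Rightarrow> nat" where
  "degree_of G v \<equiv> out_degree (with_proj G) v"

definition min_degree :: "'a pair_pre_digraph \<Rightarrow> nat" where
  "min_degree G = Min (degree_of G ` pverts G)"

text \<open>
  The rows and columns are indexed by the enumeration \<^term>\<open>from_nat_into (pverts G)\<close>, which is
  a bijection from \<open>{..<card (pverts G)}\<close> to the vertices when there are finitely many of them.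
  Another enumeration would give a permutation-similar matrix.
\<close>

definition adjacency_mat :: "'a pair_pre_digraph \<Rightarrow> real mat" where
  "adjacency_mat G = mat (card (pverts G)) (card (pverts G))
     (\<lambda>(i, j). if (from_nat_into (pverts G) i, from_nat_into (pverts G) j) \<in> parcs G
               then 1 else 0)"

text \<open>
  Named apart from the \<open>spectral_radius\<close> of the library, which is the largest modulus of an
  eigenvalue of a complex matrix. The eigenvalues of a real symmetric matrix are all real.
\<close>

definition graph_spectral_radius :: "'a pair_pre_digraph \<Rightarrow> real" where
  "graph_spectral_radius G = Max (spectrum (adjacency_mat G))"

definition complete_graph :: "nat \<Rightarrow> nat pair_pre_digraph" where
  "complete_graph m =
     \<lparr>pverts = {..<m}, parcs = {(u, v). u < m \<and> v < m \<and> u \<noteq> v}\<rparr>"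

definition empty_graph :: "nat \<Rightarrow> nat pair_pre_digraph" where
  "empty_graph m = \<lparr>pverts = {..<m}, parcs = {}\<rparr>"

definition disjoint_union ::
  "'a pair_pre_digraph \<Rightarrow> 'b pair_pre_digraph \<Rightarrow> ('a + 'b) pair_pre_digraph" where
  "disjoint_union G H =
     \<lparr>pverts = pverts G <+> pverts H,
      parcs = map_prod Inl Inl ` parcs G \<union> map_prod Inr Inr ` parcs H\<rparr>"

definition graph_join ::
  "'a pair_pre_digraph \<Rightarrow> 'b pair_pre_digraph \<Rightarrow> ('a + 'b) pair_pre_digraph" where
  "graph_join G H =
     \<lparr>pverts = pverts (disjoint_union G H),
      parcs = parcs (disjoint_union G H)
        \<union> (Inl ` pverts G) \<times> (Inr ` pverts H) \<union> (Inr ` pverts H) \<times> (Inl ` pverts G)\<rparr>"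

text \<open>
  The subtraction is on natural numbers; it is the intended one when
  \<open>n \<ge> (b + 1) * \<delta> + 1\<close>.
\<close>

definition extremal_graph ::
  "nat \<Rightarrow> nat \<Rightarrow> nat \<Rightarrow> (nat + (nat + nat)) pair_pre_digraph" where
  "extremal_graph n b \<delta> =
     graph_join (complete_graph \<delta>)
       (disjoint_union (complete_graph (n - (b + 1) * \<delta> - 1)) (empty_graph (b * \<delta> + 1)))"

definition order_bound :: "nat \<Rightarrow> nat \<Rightarrow> nat" where
  "order_bound b \<delta> = max (4 * (b + 1) * \<delta> + 4) (b * \<delta> ^ 3 + \<delta>)"

text \<open>
  That \<open>H\<close> is again a \<^locale>\<open>pair_graph\<close> matters: a spanning subdigraph of \<open>G\<close> need not be
  symmetric.
\<close>

definition odd_factor :: "nat \<Rightarrow> 'a pair_pre_digraph \<Rightarrow> 'a pair_pre_digraph \<Rightarrow> bool" where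
  "odd_factor b G H \<longleftrightarrow>
     pair_graph H \<and> spanning (with_proj H) (with_proj G) \<and>
     (\<forall>v \<in> pverts G. odd (degree_of H v) \<and> 1 \<le> degree_of H v \<and> degree_of H v \<le> b)"

end

theory Submission
  imports Defs
begin

text \<open>
  By Amahashi's theorem, a graph without an odd \<open>[1,b]\<close>-factor has a vertex set \<open>S\<close> such that \<open>G - S\<close> has
  more than \<open>b * card S\<close> odd components, hence by parity at least \<open>b * card S + 2\<close>. So \<open>G\<close> is contained in
  the join of a clique on \<open>S\<close> with at least that many disjoint cliques, each of order at least
  \<open>\<delta> + 1 - card S\<close>. Every positive function \<open>z\<close> with \<open>A z \<le> c z\<close> bounds the eigenvalues by \<open>c\<close>, and
  the positive eigenfunction of that join is explicit, so no Perron-Frobenius theory is needed: by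
  convexity the worst case has all cliques but one of minimal order. For \<open>card S \<noteq> \<delta>\<close> this gives
  \<open>c = n - b * \<delta> - 2\<close>, which is smaller than the spectral radius of \<open>T(n,b,\<delta>)\<close>; for \<open>card S = \<delta>\<close> it
  gives an eigenvalue of \<open>T(n,b,\<delta>)\<close>, and equality forces \<open>G\<close> to be \<open>T(n,b,\<delta>)\<close>.
\<close>

section \<open>Parity factors\<close>

text \<open>No spectral radius is ever computed. For \<open>T(n,b,\<delta>)\<close> a single
  eigenvalue \<open>L - 1\<close> is exhibited, where \<open>L\<close> exceeds the order
  \<open>K = n - b * \<delta> - 1\<close> of its largest clique; this is why
  \<open>c = K - 1\<close> lies strictly below. For \<open>G\<close> only upper bounds by test
  functions occur. The minimal clique order \<open>p\<close> is \<open>1\<close> for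
  \<open>card S \<ge> \<delta>\<close> and \<open>\<delta> + 1 - card S\<close> otherwise. If
  \<open>card S = s\<close> differs from \<open>\<delta>\<close>, then after splitting off
  \<open>b * s + 1\<close> cliques of order \<open>p\<close> the remaining clique together with
  \<open>S\<close> has only \<open>K - e\<close> vertices with \<open>e \<ge> 1\<close>. The small
  cliques must not make up for this loss, which is a polynomial inequality between \<open>s\<close>,
  \<open>p\<close>, \<open>e\<close> and \<open>K\<close>. The order bound supplies it: its linear
  term gives \<open>K \<ge> 7 * \<delta> + 3\<close>, and its cubic term serves all
  \<open>s < \<delta>\<close> and those \<open>s > \<delta>\<close> that are close to
  \<open>\<delta>\<close>.\<close>

text \<open>The induction of Halmos and Vaughan: a nonempty proper subset \<open>Y\<close> that
  exactly exhausts its capacity is solved separately from the rest; if there is none, every nonempty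
  proper subset has a unit to spare and any single assignment is safe. Later \<open>X\<close> is a
  tight family of pieces and \<open>f s\<close> is the degree demanded at \<open>s\<close>.\<close>

lemma capacitated_marriage:
  fixes f :: "'s \<Rightarrow> nat" and N :: "'x \<Rightarrow> 's set"
  assumes "finite X" "\<And>x. x \<in> X \<Longrightarrow> finite (N x)"
    and "\<And>Y. Y \<subseteq> X \<Longrightarrow> card Y \<le> sum f (\<Union>(N ` Y))"
  shows "\<exists>g. (\<forall>x\<in>X. g x \<in> N x) \<and> (\<forall>s. card {x\<in>X. g x = s} \<le> f s)"
  using assms
proof (induction "card X" arbitrary: X N f rule: less_induct)
  case less
  note fin = less.prems(1,2) and hall = less.prems(3)
  have finY: "finite Y" if "Y \<subseteq> X" for Y
    using that fin(1) finite_subset by blast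
  have finN: "finite (\<Union>(N ` Y))" if "Y \<subseteq> X" for Y
    using that fin finY by blast
  consider "X = {}" | Y where "Y \<subset> X" "Y \<noteq> {}" "sum f (\<Union>(N ` Y)) = card Y"
    | "X \<noteq> {}" "\<And>Y. Y \<subset> X \<Longrightarrow> Y \<noteq> {} \<Longrightarrow> card Y < sum f (\<Union>(N ` Y))"
    using hall by (metis le_neq_implies_less psubset_imp_subset)
  then show ?case
  proof cases
    case 1
    then show ?thesis by simp
  next
    case (2 Y)
    let ?A = "\<Union>(N ` Y)"
    have cardY: "card Y < card X"
      using 2(1) fin(1) by (simp add: psubset_card_mono)
    have "\<exists>g. (\<forall>x\<in>Y. g x \<in> N x) \<and> (\<forall>s. card {x\<in>Y. g x = s} \<le> f s)"
      using 2(1) by (intro less.hyps cardY finY fin(2) hall) auto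
    then obtain g1 where g1: "\<forall>x\<in>Y. g1 x \<in> N x" "\<forall>s. card {x\<in>Y. g1 x = s} \<le> f s"
      by (elim exE conjE)
    have "card (X - Y) < card X"
      using 2 fin(1) by (intro psubset_card_mono) auto
    \<comment> \<open>Hall's condition for \<open>Y \<union> Z\<close> minus the equality for
      \<open>Y\<close> is the condition for \<open>Z\<close> with \<open>?A\<close> removed.\<close>
    moreover have "card Z \<le> sum f (\<Union>((\<lambda>x. N x - ?A) ` Z))" if "Z \<subseteq> X - Y" for Z
    proof -
      have Z: "Z \<subseteq> X" and Y: "Y \<subseteq> X" using that 2(1) by auto
      note fins = finY[OF Y] finY[OF Z] finN[OF Y] finN[OF Z]
      have "card Y + card Z = card (Y \<union> Z)"
        using that fins by (subst card_Un_disjoint) auto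
      also have "\<dots> \<le> sum f (\<Union>(N ` (Y \<union> Z)))"
        using that 2 by (intro hall) auto
      also have "\<Union>(N ` (Y \<union> Z)) = ?A \<union> \<Union>((\<lambda>x. N x - ?A) ` Z)"
        by auto
      also have "sum f \<dots> = sum f ?A + sum f (\<Union>((\<lambda>x. N x - ?A) ` Z))"
        using fins by (intro sum.union_disjoint) (auto intro: finite_subset[of _ "\<Union>(N ` Z)"])
      finally show ?thesis using 2 by simp
    qed
    ultimately have "\<exists>g. (\<forall>x\<in>X - Y. g x \<in> N x - ?A) \<and> (\<forall>s. card {x\<in>X - Y. g x = s} \<le> f s)"
      using fin by (intro less.hyps) auto
    then obtain g2 where g2: "\<forall>x\<in>X - Y. g2 x \<in> N x - ?A"
        "\<forall>s. card {x\<in>X - Y. g2 x = s} \<le> f s"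
      by (elim exE conjE)
    let ?g = "\<lambda>x. if x \<in> Y then g1 x else g2 x"
    have "card {x\<in>X. ?g x = s} \<le> f s" for s
    proof (cases "s \<in> ?A")
      case True
      then have "{x\<in>X. ?g x = s} = {x\<in>Y. g1 x = s}"
        using g2(1) 2(1) by fastforce
      then show ?thesis using g1(2) by simp
    next
      case False
      then have "{x\<in>X. ?g x = s} = {x\<in>X - Y. g2 x = s}"
        using g1(1) by auto
      then show ?thesis using g2(2) by simp
    qed
    moreover have "\<forall>x\<in>X. ?g x \<in> N x" using g1(1) g2(1) by auto
    ultimately have *: "(\<forall>x\<in>X. ?g x \<in> N x) \<and> (\<forall>s. card {x\<in>X. ?g x = s} \<le> f s)"
      by (intro conjI allI)
    show ?thesis by (rule exI[where x = ?g]) (rule *)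
  next
    case 3
    obtain x where x: "x \<in> X" using 3 by blast
    have "sum f (N x) \<ge> 1" using hall[of "{x}"] x by simp
    then obtain s where s: "s \<in> N x" "f s \<ge> 1"
      by (metis not_one_le_zero sum.neutral less_one not_le)
    let ?f = "f(s := f s - 1)"
    have dec: "sum f A \<le> Suc (sum ?f A)" if "finite A" for A
    proof (cases "s \<in> A")
      case True
      have "sum ?f (A - {s}) = sum f (A - {s})" by (intro sum.cong) auto
      then show ?thesis using True that by (simp add: sum.remove[of A s])
    next
      case False
      then have "sum ?f A = sum f A" by (intro sum.cong) auto
      then show ?thesis by simp
    qed
    have "card (X - {x}) < card X" using x fin(1) by (intro psubset_card_mono) auto
    moreover have "card Y \<le> sum ?f (\<Union>(N ` Y))" if "Y \<subseteq> X - {x}" for Y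
    proof (cases "Y = {}")
      case False
      then have "card Y < sum f (\<Union>(N ` Y))" using that x by (intro 3) auto
      also have "\<dots> \<le> Suc (sum ?f (\<Union>(N ` Y)))" using that by (intro dec finN) auto
      finally show ?thesis by simp
    qed simp
    ultimately have "\<exists>g. (\<forall>y\<in>X - {x}. g y \<in> N y) \<and> (\<forall>t. card {y\<in>X - {x}. g y = t} \<le> ?f t)"
      using fin by (intro less.hyps) auto
    then obtain g where g: "\<forall>y\<in>X - {x}. g y \<in> N y"
        "\<forall>t. card {y\<in>X - {x}. g y = t} \<le> ?f t"
      by (elim exE conjE)
    have "card {y\<in>X. (g(x := s)) y = t} \<le> f t" for t
    proof (cases "t = s")
      case True
      then have "{y\<in>X. (g(x := s)) y = t} = insert x {y\<in>X - {x}. g y = t}" using x by auto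
      then show ?thesis using spec[OF g(2), of t] True s fin(1) by simp
    next
      case False
      then have "{y\<in>X. (g(x := s)) y = t} = {y\<in>X - {x}. g y = t}" by auto
      then show ?thesis using spec[OF g(2), of t] False by simp
    qed
    moreover have "\<forall>y\<in>X. (g(x := s)) y \<in> N y" using g(1) s by auto
    ultimately show ?thesis by blast
  qed
qed

text \<open>
  The pieces are arbitrary unions of components of \<open>E\<close> on \<open>V - S\<close> with odd \<open>f\<close>-sum. Since such a
  union contains a component with odd \<open>f\<close>-sum, bounding the number of pieces is the same as bounding
  the number of odd components, and no notion of connectivity is needed.
\<close>

definition odd_pieces :: "'a rel \<Rightarrow> 'a set \<Rightarrow> ('a \<Rightarrow> nat) \<Rightarrow> 'a set \<Rightarrow> 'a set set \<Rightarrow> bool" where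
  "odd_pieces E V f S P \<longleftrightarrow> pairwise disjnt P \<and>
     (\<forall>C\<in>P. C \<subseteq> V - S \<and> E `` C \<subseteq> C \<union> S \<and> odd (sum f C))"

text \<open>For constant odd \<open>f\<close> this is Amahashi's condition on odd components. In
  general it is necessary for a symmetric subgraph with degrees at most \<open>f\<close> and of the
  parity of \<open>f\<close>: each odd piece must send an edge to \<open>S\<close>, and
  \<open>S\<close> absorbs at most \<open>sum f S\<close> edges. The case \<open>S = {}\<close>
  demands an even \<open>f\<close>-sum on every component.\<close>

definition barrier_free :: "'a rel \<Rightarrow> 'a set \<Rightarrow> ('a \<Rightarrow> nat) \<Rightarrow> bool" where
  "barrier_free E V f \<longleftrightarrow> (\<forall>S\<subseteq>V. \<forall>P. odd_pieces E V f S P \<longrightarrow> card P \<le> sum f S)"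

text \<open>The equality case, analogous to a barrier in matching theory. At a tight
  \<open>S\<close> the sought subgraph has no freedom: it must send exactly one edge from each piece
  to \<open>S\<close> and have degree \<open>f s\<close> at every \<open>s\<close> in
  \<open>S\<close>.\<close>

definition tight :: "'a rel \<Rightarrow> 'a set \<Rightarrow> ('a \<Rightarrow> nat) \<Rightarrow> 'a set \<Rightarrow> bool" where
  "tight E V f S \<longleftrightarrow> S \<subseteq> V \<and> (\<exists>P. odd_pieces E V f S P \<and> card P = sum f S)"

section \<open>Odd pieces and their parity\<close>

lemma barrier_freeD:
  "barrier_free E V f \<Longrightarrow> S \<subseteq> V \<Longrightarrow> odd_pieces E V f S P \<Longrightarrow> card P \<le> sum f S"
  by (auto simp: barrier_free_def)

lemma odd_pieces_finite: "finite V \<Longrightarrow> odd_pieces E V f S P \<Longrightarrow> finite P"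
  by (rule finite_subset[of _ "Pow V"]) (auto simp: odd_pieces_def)

lemma odd_pieces_subset: "odd_pieces E V f S P \<Longrightarrow> Q \<subseteq> P \<Longrightarrow> odd_pieces E V f S Q"
  by (auto simp: odd_pieces_def intro: pairwise_subset)

lemma odd_pieces_nonempty: "odd_pieces E V f S P \<Longrightarrow> C \<in> P \<Longrightarrow> C \<noteq> {}"
  by (auto simp: odd_pieces_def)

lemma even_sum_Union_odd:
  fixes f :: "'a \<Rightarrow> nat"
  assumes "finite V" "pairwise disjnt P" "\<And>C. C \<in> P \<Longrightarrow> C \<subseteq> V" "\<And>C. C \<in> P \<Longrightarrow> odd (sum f C)"
  shows "even (sum f (\<Union>P)) \<longleftrightarrow> even (card P)"
proof -
  have "finite P" using assms(1,3) finite_subset[of P "Pow V"] by auto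
  have "sum f (\<Union>P) = (sum \<circ> sum) f P"
    using assms(2) finite_subset[OF assms(3) assms(1)]
    by (intro sum.Union_disjoint) (auto simp: pairwise_def disjnt_def)
  moreover have "{C \<in> P. odd (sum f C)} = P" using assms(4) by blast
  ultimately show ?thesis using \<open>finite P\<close> by (simp add: even_sum_iff)
qed

text \<open>Parity alone: \<open>sum f V\<close> is even, so if \<open>card P\<close> and
  \<open>sum f S\<close> differ modulo 2, the leftover vertices have odd \<open>f\<close>-sum. By
  symmetry of \<open>E\<close> they have no neighbours in the pieces, so they form one more
  piece.\<close>

lemma odd_pieces_insert_rest:
  assumes "finite V" "E \<subseteq> V \<times> V" "sym E" "S \<subseteq> V" "odd_pieces E V f S P"
    and even_V: "even (sum f V)" and odd: "odd (card P + sum f S)"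
  defines "R \<equiv> V - S - \<Union>P"
  shows "odd_pieces E V f S (insert R P)" "R \<notin> P"
proof -
  have P: "\<And>C. C \<in> P \<Longrightarrow> C \<subseteq> V - S" "\<And>C. C \<in> P \<Longrightarrow> E `` C \<subseteq> C \<union> S" 
     "\<And>C. C \<in> P \<Longrightarrow> odd (sum f C)" "pairwise disjnt P"
    using assms(5) by (auto simp: odd_pieces_def)
  have V: "V = S \<union> (\<Union>P \<union> R)" unfolding R_def using P(1) assms(4) by blast
  have fin: "finite S" "finite (\<Union>P)" "finite R"
    using V assms(1) by (metis finite_Un)+
  have "sum f V = sum f S + sum f (\<Union>P \<union> R)"
    by (subst V, rule sum.union_disjoint) (use P(1) fin in \<open>auto simp: R_def\<close>)
  also have "sum f (\<Union>P \<union> R) = sum f (\<Union>P) + sum f R"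
    by (rule sum.union_disjoint) (use fin in \<open>auto simp: R_def\<close>)
  finally have *: "sum f V = sum f S + (sum f (\<Union>P) + sum f R)" .
  have "even (sum f (\<Union>P)) \<longleftrightarrow> even (card P)"
    using P(1) by (intro even_sum_Union_odd[OF assms(1) P(4) _ P(3)]) auto
  then have oddR: "odd (sum f R)" using even_V odd * by (metis even_add)
  moreover have "E `` R \<subseteq> R \<union> S"
  proof
    fix y assume "y \<in> E `` R"
    then obtain x where x: "x \<in> R" "(x, y) \<in> E" by auto
    then have "(y, x) \<in> E" "y \<in> V" using assms(2,3) by (auto dest: symD)
    then show "y \<in> R \<union> S" using x P(2) unfolding R_def by blast
  qed
  ultimately show "odd_pieces E V f S (insert R P)"
    using assms(5) unfolding odd_pieces_def R_def
    by (auto simp: pairwise_insert disjnt_def)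
  have "R \<noteq> {}" using oddR by auto
  then show "R \<notin> P" unfolding R_def by auto
qed

lemma barrier_free_even:
  assumes "barrier_free E V f" "E `` D \<subseteq> D" "D \<subseteq> V"
  shows "even (sum f D)"
  using barrier_freeD[OF assms(1), of "{}" "{D}"] assms by (auto simp: odd_pieces_def)

text \<open>A deficit of exactly one is excluded by parity, since the leftover vertices would be the
  missing piece. The gap of two is what pays for changing \<open>f\<close> at the two ends of an
  edge.\<close>

lemma not_tight_gap:
  assumes "finite V" "E \<subseteq> V \<times> V" "sym E" "barrier_free E V f" "S \<subseteq> V" "odd_pieces E V f S P"
    and "\<not> tight E V f S"
  shows "card P + 2 \<le> sum f S"
proof (rule ccontr)
  assume "\<not> ?thesis"
  moreover have "card P \<le> sum f S" "card P \<noteq> sum f S"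
    using barrier_freeD assms by (auto simp: tight_def)
  ultimately have c: "sum f S = Suc (card P)" by simp
  have "even (sum f V)" using barrier_free_even[of E V f V] assms by auto
  note odd_pieces_insert_rest[OF assms(1,2,3,5,6) this]
  moreover have "finite P" using assms odd_pieces_finite by blast
  ultimately have "odd_pieces E V f S (insert (V - S - \<Union>P) P)"
     "card (insert (V - S - \<Union>P) P) = sum f S" using c by auto
  then show False using assms(5,7) unfolding tight_def by blast
qed

lemma odd_pieces_card_containing:
  assumes "odd_pieces E V f S P" "finite V"
  shows "card {C\<in>P. u \<in> C} \<le> (if u \<in> S then 0 else 1)"
proof (cases "u \<in> S")
  case True
  then have *: "{C\<in>P. u \<in> C} = {}" using assms by (auto simp: odd_pieces_def)
  show ?thesis unfolding * by simp
next
  case False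
  have "C = D" if "C \<in> P" "D \<in> P" "u \<in> C" "u \<in> D" for C D
    using that assms unfolding odd_pieces_def pairwise_def disjnt_def by blast
  then have "card {C\<in>P. u \<in> C} \<le> 1"
    using odd_pieces_finite[OF assms(2,1)] by (subst card_le_Suc0_iff_eq[folded One_nat_def]) auto
  then show ?thesis using False by simp
qed

lemma sum_decrement:
  fixes f :: "'a \<Rightarrow> nat"
  assumes "finite A" "f u \<ge> 1"
  shows "sum (f(u := f u - 1)) A + (if u \<in> A then 1 else 0) = sum f A"
proof (cases "u \<in> A")
  case True
  have "sum (f(u := f u - 1)) (A - {u}) = sum f (A - {u})" by (intro sum.cong) auto
  then show ?thesis using True assms by (simp add: sum.remove[of A u])
next
  case False
  then have "sum (f(u := f u - 1)) A = sum f A" by (intro sum.cong) auto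
  then show ?thesis using False by simp
qed

text \<open>
  If both choices failed, there would be closed sets \<open>D1\<close>, \<open>D2\<close> of \<open>E - uv\<close>, each separating \<open>u\<close> from \<open>v\<close>,
  with \<open>f\<close>-sums of opposite parity; their symmetric difference is closed in \<open>E\<close> with odd \<open>f\<close>-sum.
\<close>

lemma barrier_free_delete_edge:
  fixes f :: "'a \<Rightarrow> nat"
  assumes "finite V" "E \<subseteq> V \<times> V" "sym E" "barrier_free E V f" "(u, v) \<in> E" "u \<noteq> v"
    and gap: "\<And>S P. S \<subseteq> V \<Longrightarrow> S \<noteq> {} \<Longrightarrow> odd_pieces E V f S P \<Longrightarrow> card P + 2 \<le> sum f S"
    and pos: "f u \<ge> 1" "f v \<ge> 1"
  defines "E' \<equiv> E - {(u, v), (v, u)}" and "f' \<equiv> f(u := f u - 1, v := f v - 1)"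
  shows "barrier_free E' V f \<or> barrier_free E' V f'"
proof -
  have f'_sum: "sum f' A + (if u \<in> A then 1 else 0) + (if v \<in> A then 1 else 0) = sum f A"
    if "A \<subseteq> V" for A
  proof -
    have "finite A" using that assms(1) finite_subset by blast
    then show ?thesis
      using sum_decrement[of A f u] sum_decrement[of A "f(u := f u - 1)" v] pos assms(6)
      by (simp add: f'_def)
  qed
  \<comment> \<open>The gap of two suffices for nonempty \<open>T\<close>: each of \<open>u\<close>,
    \<open>v\<close> costs at most one, either as a member of \<open>T\<close>, lowering the sum of
    \<open>f'\<close>, or as a member of a single piece that stops being one for \<open>E\<close>
    and \<open>f\<close>.\<close>
  have bound: "card Q \<le> sum f T \<and> card Q \<le> sum f' T"
    if T: "T \<subseteq> V" "T \<noteq> {}" and h: "h = f \<or> h = f'" and Q: "odd_pieces E' V h T Q" for T Q h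
  proof -
    let ?Q = "{C\<in>Q. u \<notin> C \<and> v \<notin> C}"
    have finQ: "finite Q" using Q assms(1) odd_pieces_finite by blast
    have "odd_pieces E V f T ?Q"
      unfolding odd_pieces_def
    proof (intro conjI ballI)
      show "pairwise disjnt ?Q"
        using Q by (auto simp: odd_pieces_def intro: pairwise_subset)
      fix C assume C: "C \<in> ?Q"
      then have C': "C \<subseteq> V - T" "E' `` C \<subseteq> C \<union> T" "odd (sum h C)"
        using Q by (auto simp: odd_pieces_def)
      show "C \<subseteq> V - T" by fact
      show "E `` C \<subseteq> C \<union> T" using C' C unfolding E'_def by blast
      have "C \<subseteq> V" using C' by auto
      show "odd (sum f C)" using f'_sum[OF \<open>C \<subseteq> V\<close>] C C' h by auto
    qed
    then have g: "card ?Q + 2 \<le> sum f T" using gap T by blast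
    have "Q \<subseteq> ?Q \<union> {C\<in>Q. u \<in> C} \<union> {C\<in>Q. v \<in> C}" by auto
    then have "card Q \<le> card (?Q \<union> {C\<in>Q. u \<in> C} \<union> {C\<in>Q. v \<in> C})"
      using finQ by (intro card_mono) auto
    also have "\<dots> \<le> card ?Q + card {C\<in>Q. u \<in> C} + card {C\<in>Q. v \<in> C}"
      by (meson add_le_mono card_Un_le le_refl le_trans)
    finally have "card Q \<le> card ?Q + (if u \<in> T then 0 else 1) + (if v \<in> T then 0 else 1)"
      using odd_pieces_card_containing[OF Q assms(1), of u]
        odd_pieces_card_containing[OF Q assms(1), of v] by linarith
    then show ?thesis using g f'_sum[OF T(1)] by (auto split: if_splits)
  qed
  have symE': "sym E'" using assms(3) unfolding E'_def sym_def by auto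
  have even: "even (sum f D)" if "D \<subseteq> V" "E `` D \<subseteq> D" for D
    using barrier_free_even assms(4) that by blast
  have closed: "E `` D \<subseteq> D" if "E' `` D \<subseteq> D" "u \<in> D \<longleftrightarrow> v \<in> D" for D
    using that unfolding E'_def by auto
  show ?thesis
  proof (rule ccontr)
    assume "\<not> ?thesis"
    then have "\<not> barrier_free E' V f" "\<not> barrier_free E' V f'" by auto
    have bad: "\<exists>D\<subseteq>V. E' `` D \<subseteq> D \<and> odd (sum h D)" if nb: "\<not> barrier_free E' V h" and h: "h = f \<or> h = f'" for h
    proof -
      obtain T Q where "T \<subseteq> V" "odd_pieces E' V h T Q" "\<not> card Q \<le> sum h T"
        using nb unfolding barrier_free_def by blast
      moreover from this have "T = {}" using bound h by blast
      moreover from calculation have "Q \<noteq> {}" by auto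
      ultimately show ?thesis by (fastforce simp: odd_pieces_def)
    qed
    obtain D2 where D2: "D2 \<subseteq> V" "E' `` D2 \<subseteq> D2" "odd (sum f D2)"
      using bad[of f] \<open>\<not> barrier_free E' V f\<close> by blast
    then have D2uv: "u \<in> D2 \<longleftrightarrow> v \<notin> D2" using even closed by blast
    obtain D1 where D1: "D1 \<subseteq> V" "E' `` D1 \<subseteq> D1" "odd (sum f' D1)"
      using bad[of f'] \<open>\<not> barrier_free E' V f'\<close> by blast
    \<comment> \<open>If \<open>D1\<close> did not separate \<open>u\<close> from \<open>v\<close>,
      it would be closed in \<open>E\<close> and its sums under \<open>f\<close> and
      \<open>f'\<close> would have the same parity.\<close>
    have D1uv: "u \<in> D1 \<longleftrightarrow> v \<notin> D1"
    proof (rule ccontr)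
      assume "\<not> ?thesis"
      then show False using even[of D1] closed[of D1] D1 f'_sum[OF D1(1)] by (auto split: if_splits) presburger+
    qed
    then have "sum f D1 = Suc (sum f' D1)" using f'_sum[OF D1(1)] by (cases "u \<in> D1") auto
    then have D1e: "even (sum f D1)" using D1(3) by simp
    let ?D = "(D1 - D2) \<union> (D2 - D1)"
    have "E' `` ?D \<subseteq> ?D" using D1(2) D2(2) symE' by (auto dest: symD)
    then have "even (sum f ?D)" using even[of ?D] closed[of ?D] D1 D2 D1uv D2uv by blast
    moreover have fin: "finite D1" "finite D2" using D1 D2 assms(1) finite_subset by blast+
    have "sum f ?D = sum f (D1 - D2) + sum f (D2 - D1)"
      using fin by (intro sum.union_disjoint) auto
    moreover have "sum f D1 = sum f (D1 - D2) + sum f (D1 \<inter> D2)"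
      using fin by (metis add.commute sum.Int_Diff)
    moreover have "sum f D2 = sum f (D2 - D1) + sum f (D1 \<inter> D2)"
      using fin by (metis add.commute sum.Int_Diff inf_commute)
    ultimately show False using D1e D2(3) by auto
  qed
qed

section \<open>Passing to the pieces of a maximal tight set\<close>

text \<open>All arcs leaving \<open>W\<close> end in \<open>S\<close>, so pieces found inside
  \<open>W\<close> remain pieces in the whole graph once \<open>T\<close> joins \<open>S\<close>. It
  is applied with \<open>W\<close> one of the pieces (removed from the family) and with
  \<open>W\<close> the set of leftover vertices; it lifts local barriers to global ones.\<close>

lemma odd_pieces_refine:
  assumes "finite V" "odd_pieces E V f S P" "W \<subseteq> V - S" "E `` W \<subseteq> W \<union> S" "disjnt W (\<Union>P)"
    and "T \<subseteq> W" "odd_pieces (E \<inter> W \<times> W) W f T Q"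
  shows "odd_pieces E V f (S \<union> T) (P \<union> Q)" "card (P \<union> Q) = card P + card Q"
proof -
  have Q: "D \<subseteq> W" if "D \<in> Q" for D using assms(7) that by (auto simp: odd_pieces_def)
  have WP: "disjnt C D" if "C \<in> P" "D \<subseteq> W" for C D
    using that assms(5) by (auto simp: disjnt_def)
  show "odd_pieces E V f (S \<union> T) (P \<union> Q)"
    unfolding odd_pieces_def
  proof (intro conjI ballI)
    show "pairwise disjnt (P \<union> Q)"
      using assms(2,7) WP Q unfolding odd_pieces_def pairwise_def by (auto simp: disjnt_sym)
    fix C assume C: "C \<in> P \<union> Q"
    show "C \<subseteq> V - (S \<union> T)"
    proof (cases "C \<in> P")
      case True
      then have "C \<subseteq> V - S" using assms(2) by (auto simp: odd_pieces_def)
      then show ?thesis using WP[OF True assms(6)] by (auto simp: disjnt_def)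
    next
      case False
      then have "C \<subseteq> W - T" using C assms(7) by (auto simp: odd_pieces_def)
      then show ?thesis using assms(3) by auto
    qed
    show "odd (sum f C)" using C assms(2,7) by (auto simp: odd_pieces_def)
    show "E `` C \<subseteq> C \<union> (S \<union> T)"
    proof (cases "C \<in> P")
      case True then show ?thesis using assms(2) by (auto simp: odd_pieces_def)
    next
      case False
      then have "C \<in> Q" using C by simp
      then have "C \<subseteq> W" "(E \<inter> W \<times> W) `` C \<subseteq> C \<union> T" using assms(7) by (auto simp: odd_pieces_def)
      then show ?thesis using assms(4) by blast
    qed
  qed
  have "P \<inter> Q = {}"
    using WP Q odd_pieces_nonempty[OF assms(2)] by (metis disjoint_iff disjnt_self_iff_empty)
  moreover have "finite P" using assms odd_pieces_finite by blast
  moreover have "finite Q" using assms odd_pieces_finite[OF _ assms(7)] finite_subset[OF assms(3)] by blast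
  ultimately show "card (P \<union> Q) = card P + card Q" by (simp add: card_Un_disjoint)
qed


text \<open>The counterpart of factor-criticality in the Gallai-Edmonds structure: the single edge
  from \<open>C\<close> to \<open>S\<close> may end at any \<open>v\<close>. A violation at a
  nonempty \<open>T\<close> would, together with \<open>S\<close>, contradict the maximality of
  \<open>S\<close>; one at the empty set is a closed \<open>D\<close> with odd lowered sum, and then
  \<open>D\<close> or \<open>C - D\<close> is a smaller odd piece, against minimality of
  \<open>C\<close>.\<close>

lemma barrier_free_piece:
  fixes f :: "'a \<Rightarrow> nat"
  assumes "finite V" "E \<subseteq> V \<times> V" "sym E" "barrier_free E V f" "S \<subseteq> V"
    and P: "odd_pieces E V f S P" "card P = sum f S" and C: "C \<in> P" "v \<in> C"
    and max: "\<And>T. T \<subseteq> V - S \<Longrightarrow> T \<noteq> {} \<Longrightarrow> \<not> tight E V f (S \<union> T)"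
    and min: "\<And>D. D \<subset> C \<Longrightarrow> E `` D \<subseteq> D \<union> S \<Longrightarrow> even (sum f D)"
  shows "f v \<ge> 1" "barrier_free (E \<inter> C \<times> C) C (f(v := f v - 1))"
proof -
  have C_props: "C \<subseteq> V - S" "E `` C \<subseteq> C \<union> S" "odd (sum f C)"
    using P(1) C(1) by (auto simp: odd_pieces_def)
  have finC: "finite C" using C_props assms(1) finite_subset by blast
  have finP: "finite P" using P(1) assms(1) odd_pieces_finite by blast
  have P': "odd_pieces E V f S (P - {C})" using P(1) by (rule odd_pieces_subset) auto
  have dC: "disjnt C (\<Union>(P - {C}))"
    using P(1) C(1) by (auto simp: odd_pieces_def pairwise_def disjnt_def)
  have cP: "Suc (card (P - {C})) = sum f S"
    using finP C(1) P(2) by (metis card_Suc_Diff1)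
  have gap: "card (P - {C}) + card Q + 2 \<le> sum f S + sum f T"
    if "T \<subseteq> C" "T \<noteq> {}" "odd_pieces (E \<inter> C \<times> C) C f T Q" for T Q
  proof -
    have r: "odd_pieces E V f (S \<union> T) (P - {C} \<union> Q)" "card (P - {C} \<union> Q) = card (P - {C}) + card Q"
      using odd_pieces_refine[OF assms(1) P' C_props(1,2) dC that(1,3)] by auto
    have "T \<subseteq> V - S" using that C_props by blast
    then have "\<not> tight E V f (S \<union> T)" "S \<union> T \<subseteq> V" using max that(2) assms(5) by auto
    from not_tight_gap[OF assms(1-4) this(2) r(1) this(1)]
    have "card (P - {C} \<union> Q) + 2 \<le> sum f (S \<union> T)" .
    also have "sum f (S \<union> T) = sum f S + sum f T"
      using assms(1,5) \<open>T \<subseteq> V - S\<close> by (intro sum.union_disjoint) (auto intro: finite_subset)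
    finally show ?thesis using r(2) by simp
  qed
  \<comment> \<open>The gap at \<open>T = {v}\<close> with no pieces at all already forces positive
    demand at \<open>v\<close>.\<close>
  have "odd_pieces (E \<inter> C \<times> C) C f {v} {}" by (auto simp: odd_pieces_def)
  from gap[OF _ _ this] show fv: "f v \<ge> 1" using C(2) cP by simp
  let ?f = "f(v := f v - 1)"
  have f_sum: "sum ?f A + (if v \<in> A then 1 else 0) = sum f A" if "A \<subseteq> C" for A
    using sum_decrement[of A f v] fv that finC finite_subset by blast
  show "barrier_free (E \<inter> C \<times> C) C ?f"
    unfolding barrier_free_def
  proof (intro allI impI)
    fix T Q assume T: "T \<subseteq> C" and Q: "odd_pieces (E \<inter> C \<times> C) C ?f T Q"
    have finQ: "finite Q" using Q finC odd_pieces_finite by blast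
    show "card Q \<le> sum ?f T"
    proof (cases "T = {}")
      case False
      let ?Q = "{D\<in>Q. v \<notin> D}"
      have "odd_pieces (E \<inter> C \<times> C) C f T ?Q"
        unfolding odd_pieces_def
      proof (intro conjI ballI)
        show "pairwise disjnt ?Q"
          using Q by (auto simp: odd_pieces_def intro: pairwise_subset)
        fix D assume D: "D \<in> ?Q"
        then have D': "D \<subseteq> C - T" "(E \<inter> C \<times> C) `` D \<subseteq> D \<union> T" "odd (sum ?f D)"
          using Q unfolding odd_pieces_def by blast+
        show "D \<subseteq> C - T" "(E \<inter> C \<times> C) `` D \<subseteq> D \<union> T" by fact+
        have "D \<subseteq> C" using D'(1) by auto
        then show "odd (sum f D)" using f_sum[OF \<open>D \<subseteq> C\<close>] D D'(3) by simp
      qed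
      from gap[OF T False this] have g: "card ?Q + 1 \<le> sum f T" using cP by simp
      have "Q \<subseteq> ?Q \<union> {D\<in>Q. v \<in> D}" by auto
      then have "card Q \<le> card (?Q \<union> {D\<in>Q. v \<in> D})"
        using finQ by (intro card_mono) auto
      also have "\<dots> \<le> card ?Q + card {D\<in>Q. v \<in> D}" by (rule card_Un_le)
      also have "card {D\<in>Q. v \<in> D} \<le> (if v \<in> T then 0 else 1)"
        by (rule odd_pieces_card_containing[OF Q finC])
      finally show ?thesis using g f_sum[OF T] by (auto split: if_splits)
    next
      case True
      have "Q = {}"
      proof (rule ccontr)
        assume "Q \<noteq> {}"
        then obtain D where "D \<in> Q" by blast
        then have D: "D \<subseteq> C" "(E \<inter> C \<times> C) `` D \<subseteq> D" "odd (sum ?f D)"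
          using Q True unfolding odd_pieces_def by auto
        have ED: "E `` D \<subseteq> D \<union> S" using D C_props(2) by blast
        show False
        proof (cases "v \<in> D")
          case False
          then have "D \<subset> C" using D C(2) by auto
          then show False using min[OF _ ED] f_sum[OF D(1)] D(3) False by simp
        next
          case True
          have "E `` (C - D) \<subseteq> (C - D) \<union> S"
          proof
            fix y assume "y \<in> E `` (C - D)"
            then obtain x where x: "x \<in> C - D" "(x, y) \<in> E" by auto
            then have "(y, x) \<in> E" "y \<in> C \<union> S" using assms(3) C_props(2) by (auto dest: symD)
            then show "y \<in> (C - D) \<union> S" using x D(2) by auto
          qed
          moreover have "C - D \<subset> C" using True C(2) by auto
          ultimately have "even (sum f (C - D))" using min by blast
          moreover have "sum f C = sum f D + sum f (C - D)"
            using D(1) finC by (metis add.commute sum.subset_diff)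
          moreover have "even (sum f D)" using f_sum[OF D(1)] D(3) True by (metis odd_even_add odd_one)
          ultimately show False using C_props(3) by simp
        qed
      qed
      then show ?thesis by simp
    qed
  qed
qed

text \<open>
  The case \<open>f = (\<lambda>_. b)\<close> with \<open>b\<close> odd is Amahashi's theorem. The general \<open>f\<close> makes the induction work:
  take a maximal tight \<open>S\<close> and a tight family of pieces with the fewest vertices. If \<open>S\<close> is empty,
  delete an edge. Otherwise match every piece \<open>C\<close> to some \<open>g C \<in> S\<close> by an edge ending in \<open>p C \<in> C\<close>, so
  that \<open>s \<in> S\<close> gets exactly \<open>f s\<close> pieces, and recurse into the pieces with \<open>f (p C)\<close> lowered by one.
\<close>

theorem parity_factor:
  fixes f :: "'a \<Rightarrow> nat"
  assumes "finite V" "E \<subseteq> V \<times> V" "sym E" "irrefl E" "barrier_free E V f"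
  shows "\<exists>H\<subseteq>E. sym H \<and> (\<forall>v\<in>V. card (H `` {v}) \<le> f v \<and> even (card (H `` {v}) + f v))"
  using assms
proof (induction "card V + card E" arbitrary: V E f rule: less_induct)
  case less
  note fin = less.prems(1) and EV = less.prems(2) and sym = less.prems(3) and irr = less.prems(4)
    and bf = less.prems(5)
  have finE: "finite E" using EV fin by (meson finite_SigmaI finite_subset)
  have loop: "x \<noteq> y" if "(x, y) \<in> E" for x y using that irr by (auto simp: irrefl_def)
  have "odd_pieces E V f {} {}" by (simp add: odd_pieces_def)
  then have "tight E V f {}" by (fastforce simp: tight_def)
  moreover have "finite {S. tight E V f S}"
    by (rule finite_subset[of _ "Pow V"]) (use fin in \<open>auto simp: tight_def\<close>)
  ultimately have "\<exists>S\<in>{S. tight E V f S}. \<forall>S'\<in>{S. tight E V f S}. S \<subseteq> S' \<longrightarrow> S = S'"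
    by (intro finite_has_maximal) auto
  then obtain S where S: "tight E V f S" "\<And>S'. tight E V f S' \<Longrightarrow> S \<subseteq> S' \<Longrightarrow> S' = S"
    by blast
  have SV: "S \<subseteq> V" using S(1) by (simp add: tight_def)
  show ?case
  proof (cases "S = {}")
    case True
    have gap: "card P + 2 \<le> sum f T" if "T \<subseteq> V" "T \<noteq> {}" "odd_pieces E V f T P" for T P
      using not_tight_gap[OF fin EV sym bf that(1,3)] S(2)[of T] True that(2) by auto
    show ?thesis
    proof (cases "E = {}")
      case True
      \<comment> \<open>Without edges every singleton is closed, so all demands are even and the
        empty subgraph meets them.\<close>
      have "even (f v)" if "v \<in> V" for v
        using barrier_free_even[OF bf, of "{v}"] that True by simp
      then show ?thesis using True by (intro exI[of _ "{}"]) (auto simp: sym_def)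
    next
      case False
      then obtain u v where uv: "(u, v) \<in> E" by auto
      then have uvV: "u \<in> V" "v \<in> V" "u \<noteq> v" "(v, u) \<in> E" using EV loop sym by (auto dest: symD)
      have "odd_pieces E V f {u} {}" "odd_pieces E V f {v} {}" by (auto simp: odd_pieces_def)
      then have pos: "f u \<ge> 1" "f v \<ge> 1" using gap[of "{u}" "{}"] gap[of "{v}" "{}"] uvV by auto
      let ?E = "E - {(u, v), (v, u)}" and ?f = "f(u := f u - 1, v := f v - 1)"
      have E: "?E \<subseteq> V \<times> V" "sym ?E" "irrefl ?E" "card V + card ?E < card V + card E"
        using EV sym irr finE uv by (auto simp: sym_def irrefl_def intro!: psubset_card_mono)
      have "barrier_free ?E V f \<or> barrier_free ?E V ?f"
        by (rule barrier_free_delete_edge[OF fin EV sym bf uv uvV(3) _ pos]) (rule gap)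
      then show ?thesis
      proof
        assume 1: "barrier_free ?E V f"
        show ?thesis using less.hyps[OF E(4) fin E(1-3) 1] by blast
      next
        assume 2: "barrier_free ?E V ?f"
        obtain H where H: "H \<subseteq> ?E" "sym H"
            "\<And>w. w \<in> V \<Longrightarrow> card (H `` {w}) \<le> ?f w \<and> even (card (H `` {w}) + ?f w)"
          using less.hyps[OF E(4) fin E(1-3) 2] by blast
        let ?H = "H \<union> {(u, v), (v, u)}"
        have finH: "finite (H `` {w})" for w
          using finite_subset[OF H(1)] finE by (intro finite_Image) simp
        have "card (?H `` {w}) \<le> f w \<and> even (card (?H `` {w}) + f w)" if "w \<in> V" for w
        proof -
          consider "w = u" | "w = v" | "w \<noteq> u" "w \<noteq> v" by blast
          then show ?thesis
          proof cases
            case 1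
            then have "?H `` {w} = insert v (H `` {w})" "v \<notin> H `` {w}" using H(1) uvV by auto
            then have "card (?H `` {w}) = Suc (card (H `` {w}))" using finH by simp
            moreover have "f w = Suc (?f w)" using 1 uvV(3) pos by simp
            ultimately show ?thesis using H(3)[OF that] by (simp only: Suc_le_mono) simp
          next
            case 2
            then have "?H `` {w} = insert u (H `` {w})" "u \<notin> H `` {w}" using H(1) uvV by auto
            then have "card (?H `` {w}) = Suc (card (H `` {w}))" using finH by simp
            moreover have "f w = Suc (?f w)" using 2 uvV(3) pos by simp
            ultimately show ?thesis using H(3)[OF that] by (simp only: Suc_le_mono) simp
          next
            case 3
            then have "?H `` {w} = H `` {w}" by auto
            then show ?thesis using H(3)[OF that] 3 by simp
          qed
        qed
        moreover have "?H \<subseteq> E" "sym ?H" using H uv uvV by (auto simp: sym_def)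
        ultimately show ?thesis by blast
      qed
    qed
  next
    case False
    let ?good = "\<lambda>P. odd_pieces E V f S P \<and> card P = sum f S"
    \<comment> \<open>Fewest vertices makes every piece minimal: a smaller closed part of it with
      odd sum could replace it. This is \<open>min\<close> below.\<close>
    obtain P where P: "?good P" "\<And>P'. ?good P' \<Longrightarrow> card (\<Union>P) \<le> card (\<Union>P')"
      using S(1) ex_has_least_nat[of ?good _ "\<lambda>P. card (\<Union>P)"] unfolding tight_def by blast
    have Pp: "C \<subseteq> V - S" "E `` C \<subseteq> C \<union> S" "odd (sum f C)" "C \<noteq> {}" "finite C" if "C \<in> P" for C
    proof -
      show "C \<subseteq> V - S" "E `` C \<subseteq> C \<union> S" "odd (sum f C)" using P(1) that by (auto simp: odd_pieces_def)
      then show "C \<noteq> {}" "finite C" using fin by (auto intro: finite_subset)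
    qed
    have disj: "C = D" if "C \<in> P" "D \<in> P" "x \<in> C" "x \<in> D" for C D x
      using P(1) that unfolding odd_pieces_def pairwise_def disjnt_def by blast
    have finP: "finite P" using P(1) fin odd_pieces_finite by blast
    have max: "\<not> tight E V f (S \<union> T)" if "T \<subseteq> V - S" "T \<noteq> {}" for T
      using S(2)[of "S \<union> T"] that by blast
    have min: "even (sum f D)" if C: "C \<in> P" and D: "D \<subset> C" "E `` D \<subseteq> D \<union> S" for C D
    proof (rule ccontr)
      assume odd: "odd (sum f D)"
      then have "D \<noteq> {}" by auto
      let ?P = "insert D (P - {C})"
      have "D \<notin> P - {C}" using \<open>D \<noteq> {}\<close> D disj C by blast
      then have "card ?P = card P" using C finP by (metis card_Suc_Diff1 card_insert_disjoint finite_Diff)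
      moreover have "odd_pieces E V f S ?P"
        unfolding odd_pieces_def
      proof (intro conjI ballI)
        show "pairwise disjnt ?P"
          using P(1) C D(1) unfolding odd_pieces_def pairwise_def disjnt_def by blast
        fix B assume "B \<in> ?P"
        then show "B \<subseteq> V - S" "E `` B \<subseteq> B \<union> S" "odd (sum f B)"
          using Pp odd D C by blast+
      qed
      ultimately have "card (\<Union>P) \<le> card (\<Union>?P)" using P(1) by (intro P(2)) simp
      moreover have "\<Union>?P \<subset> \<Union>P"
      proof -
        obtain x where x: "x \<in> C" "x \<notin> D" using D by blast
        then have "x \<notin> \<Union>?P" using disj C by blast
        then show ?thesis using x C D by blast
      qed
      moreover have "finite (\<Union>P)" using finP Pp by blast
      ultimately show False by (meson not_le psubset_card_mono)
    qed
    let ?N = "\<lambda>C. {s\<in>S. \<exists>v\<in>C. (s, v) \<in> E}"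
    have finS: "finite S" using SV fin finite_subset by blast
    have "\<exists>g. (\<forall>C\<in>P. g C \<in> ?N C) \<and> (\<forall>s. card {C\<in>P. g C = s} \<le> f s)"
    proof (rule capacitated_marriage)
      show "finite P" by fact
      show "finite (?N C)" for C using finS by simp
      fix Y assume Y: "Y \<subseteq> P"
      \<comment> \<open>Hall's condition is \<open>barrier_free\<close> at the set of neighbours of
        \<open>Y\<close> in \<open>S\<close>: the members of \<open>Y\<close> are still odd pieces
        when only those neighbours are removed.\<close>
      have "odd_pieces E V f (\<Union>(?N ` Y)) Y"
        unfolding odd_pieces_def
      proof (intro conjI ballI)
        show "pairwise disjnt Y" using P(1) Y by (auto simp: odd_pieces_def intro: pairwise_subset)
        fix C assume C: "C \<in> Y"
        then have CP: "C \<in> P" using Y by auto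
        show "C \<subseteq> V - \<Union>(?N ` Y)" using Pp(1)[OF CP] by auto
        show "odd (sum f C)" by (rule Pp(3)[OF CP])
        show "E `` C \<subseteq> C \<union> \<Union>(?N ` Y)"
        proof
          fix y assume "y \<in> E `` C"
          then obtain x where x: "x \<in> C" "(x, y) \<in> E" by auto
          then have "(y, x) \<in> E" "y \<in> C \<union> S" using Pp(2)[OF CP] sym by (auto dest: symD)
          then show "y \<in> C \<union> \<Union>(?N ` Y)" using C x by auto
        qed
      qed
      moreover have "\<Union>(?N ` Y) \<subseteq> V" using SV by auto
      ultimately show "card Y \<le> sum f (\<Union>(?N ` Y))" by (intro barrier_freeD[OF bf])
    qed
    then obtain g where g: "\<forall>C\<in>P. g C \<in> ?N C" "\<forall>s. card {C\<in>P. g C = s} \<le> f s"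
      by (elim exE conjE)
    have "card P = (\<Sum>s\<in>S. card {C\<in>P. g C = s})"
      using g(1) finP finS by (subst card_eq_sum, subst sum.group[symmetric, of _ S g]) auto
    then have sum_eq: "(\<Sum>s\<in>S. card {C\<in>P. g C = s}) = sum f S" using P(1) by simp
    \<comment> \<open>Tightness makes the totals agree, so each upper bound \<open>f s\<close> is
      attained and the matching edges alone give \<open>s\<close> its full degree.\<close>
    have g_eq: "card {C\<in>P. g C = s} = f s" if "s \<in> S" for s
      using sum_mono_inv[OF sum_eq _ that finS] g(2) by blast
    have "\<forall>C\<in>P. \<exists>v\<in>C. (g C, v) \<in> E" using g(1) by blast
    then obtain p where p: "\<And>C. C \<in> P \<Longrightarrow> p C \<in> C \<and> (g C, p C) \<in> E" by metis
    have gS: "g C \<in> S" if "C \<in> P" for C using g(1) that by blast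
    have smaller: "card W + card (E \<inter> W \<times> W) < card V + card E" "finite W"
        "E \<inter> W \<times> W \<subseteq> W \<times> W" "sym (E \<inter> W \<times> W)" "irrefl (E \<inter> W \<times> W)"
      if "W \<subseteq> V - S" for W
    proof -
      have "card W < card V" using that False SV fin by (intro psubset_card_mono) auto
      moreover have "card (E \<inter> W \<times> W) \<le> card E" using finE by (intro card_mono) auto
      ultimately show "card W + card (E \<inter> W \<times> W) < card V + card E" by simp
      show "finite W" using that fin finite_subset by blast
      show "sym (E \<inter> W \<times> W)" "irrefl (E \<inter> W \<times> W)" "E \<inter> W \<times> W \<subseteq> W \<times> W"
        using sym irr by (auto simp: sym_def irrefl_def)
    qed
    have "\<exists>H\<subseteq>E \<inter> C \<times> C. sym H \<and> (\<forall>v\<in>C. card (H `` {v}) + (if v = p C then 1 else 0) \<le> f v \<and>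
        even (card (H `` {v}) + (if v = p C then 1 else 0) + f v))" if C: "C \<in> P" for C
    proof -
      let ?f = "f(p C := f (p C) - 1)"
      have pC: "p C \<in> C" using p C by blast
      have *: "f (p C) \<ge> 1" "barrier_free (E \<inter> C \<times> C) C ?f"
        using barrier_free_piece[OF fin EV sym bf SV _ _ C pC max] P(1) min[OF C] by blast+
      obtain H where H: "H \<subseteq> E \<inter> C \<times> C" "sym H"
          "\<And>v. v \<in> C \<Longrightarrow> card (H `` {v}) \<le> ?f v \<and> even (card (H `` {v}) + ?f v)"
        using less.hyps[OF smaller[OF Pp(1)[OF C]] *(2)] by meson
      have "card (H `` {v}) + (if v = p C then 1 else 0) \<le> f v \<and>
        even (card (H `` {v}) + (if v = p C then 1 else 0) + f v)" if "v \<in> C" for v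
        using H(3)[OF that] *(1) by (auto split: if_splits)
      then show ?thesis using H(1,2) by blast
    qed
    then obtain HC where HC: "\<And>C. C \<in> P \<Longrightarrow> HC C \<subseteq> E \<inter> C \<times> C" "\<And>C. C \<in> P \<Longrightarrow> sym (HC C)"
        "\<And>C v. C \<in> P \<Longrightarrow> v \<in> C \<Longrightarrow> card (HC C `` {v}) + (if v = p C then 1 else 0) \<le> f v \<and>
        even (card (HC C `` {v}) + (if v = p C then 1 else 0) + f v)"
      by metis
    define R where "R = V - S - \<Union>P"
    have RV: "R \<subseteq> V - S" by (auto simp: R_def)
    have ER: "E `` R \<subseteq> R \<union> S"
    proof
      fix y assume "y \<in> E `` R"
      then obtain x where x: "x \<in> R" "(x, y) \<in> E" by auto
      then have "(y, x) \<in> E" "y \<in> V" using EV sym by (auto dest: symD)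
      then show "y \<in> R \<union> S" using x Pp(2) unfolding R_def by blast
    qed
    have RP: "disjnt R (\<Union>P)" by (auto simp: R_def disjnt_def)
    \<comment> \<open>A violation inside \<open>R\<close>, added to \<open>S\<close> and
      \<open>P\<close>, would violate the condition for \<open>E\<close>, because \<open>P\<close>
      already uses up \<open>sum f S\<close>.\<close>
    have "barrier_free (E \<inter> R \<times> R) R f"
      unfolding barrier_free_def
    proof (intro allI impI)
      fix T Q assume T: "T \<subseteq> R" and Q: "odd_pieces (E \<inter> R \<times> R) R f T Q"
      have r: "odd_pieces E V f (S \<union> T) (P \<union> Q)" "card (P \<union> Q) = card P + card Q"
        using odd_pieces_refine[OF fin conjunct1[OF P(1)] RV ER RP T Q] by blast+
      have "S \<union> T \<subseteq> V" using SV T RV by auto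
      then have "card (P \<union> Q) \<le> sum f (S \<union> T)" using r(1) bf barrier_freeD by blast
      also have "\<dots> = sum f S + sum f T"
        using finS T RV smaller(2)[OF RV] by (intro sum.union_disjoint) (auto intro: finite_subset)
      finally show "card Q \<le> sum f T" using r(2) P(1) by simp
    qed
    from less.hyps[OF smaller[OF RV] this] obtain HR where HR: "HR \<subseteq> E \<inter> R \<times> R" "sym HR"
        "\<And>v. v \<in> R \<Longrightarrow> card (HR `` {v}) \<le> f v \<and> even (card (HR `` {v}) + f v)"
      by meson
    define H where "H = HR \<union> (\<Union>C\<in>P. HC C) \<union> (\<Union>C\<in>P. {(g C, p C), (p C, g C)})"
    have H_iff: "(x, y) \<in> H \<longleftrightarrow> (x, y) \<in> HR \<or> (\<exists>C\<in>P. (x, y) \<in> HC C) \<or>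
        (\<exists>C\<in>P. x = g C \<and> y = p C) \<or> (\<exists>C\<in>P. x = p C \<and> y = g C)" for x y
      by (auto simp: H_def)
    have "H \<subseteq> E"
    proof
      fix e assume "e \<in> H"
      moreover have "(g C, p C) \<in> E" "(p C, g C) \<in> E" if "C \<in> P" for C
        using p[OF that] sym by (auto dest: symD)
      ultimately show "e \<in> E" using HR(1) HC(1) by (cases e) (auto simp: H_iff)
    qed
    moreover have "sym H"
      using HR(2) HC(2) unfolding sym_def H_iff by blast
    moreover have "card (H `` {v}) \<le> f v \<and> even (card (H `` {v}) + f v)" if v: "v \<in> V" for v
    proof -
      consider "v \<in> S" | "v \<in> R" | C where "C \<in> P" "v \<in> C" using v by (auto simp: R_def)
      then show ?thesis
      proof cases
        case 1
        have "H `` {v} = p ` {C\<in>P. g C = v}"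
        proof -
          have "(v, y) \<notin> HR" "C \<in> P \<Longrightarrow> (v, y) \<notin> HC C" "C \<in> P \<Longrightarrow> v \<noteq> p C" for y C
            using 1 HR(1) RV HC(1)[of C] Pp(1)[of C] p[of C] by auto
          then show ?thesis by (auto simp: H_iff)
        qed
        moreover have "inj_on p {C\<in>P. g C = v}" using disj p by (intro inj_onI) (metis mem_Collect_eq)
        ultimately have "card (H `` {v}) = f v" using g_eq[OF 1] by (simp add: card_image)
        then show ?thesis by simp
      next
        case 2
        have "H `` {v} = HR `` {v}"
        proof -
          have "C \<in> P \<Longrightarrow> (v, y) \<notin> HC C" "C \<in> P \<Longrightarrow> v \<noteq> p C" "C \<in> P \<Longrightarrow> v \<noteq> g C" for y C
            using 2 HC(1)[of C] p[of C] gS[of C] by (auto simp: R_def)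
          then show ?thesis by (auto simp: H_iff)
        qed
        then show ?thesis using HR(3)[OF 2] by simp
      next
        case 3
        have vR: "(v, y) \<notin> HR" for y using 3 HR(1) by (auto simp: R_def)
        have vD: "D = C" if "D \<in> P" "v \<in> D" for D using disj[OF that(1) 3(1) that(2) 3(2)] .
        have vHC: "D = C" if "D \<in> P" "(v, y) \<in> HC D" for D y
          using HC(1)[OF that(1)] that(2) by (intro vD[OF that(1)]) auto
        have vp: "D = C" if "D \<in> P" "v = p D" for D
          using p[OF that(1)] that(2) by (intro vD[OF that(1)]) auto
        have vg: "v \<noteq> g D" if "D \<in> P" for D using gS[OF that] Pp(1)[OF 3(1)] 3(2) by auto
        have "H `` {v} = HC C `` {v} \<union> (if v = p C then {g C} else {})"
        proof (rule Set.set_eqI)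
          fix y
          have "(v, y) \<in> H \<longleftrightarrow> (v, y) \<in> HC C \<or> (v = p C \<and> y = g C)"
            unfolding H_iff using vR vHC vp vg 3(1) by blast
          then show "y \<in> H `` {v} \<longleftrightarrow> y \<in> HC C `` {v} \<union> (if v = p C then {g C} else {})"
            by simp
        qed
        moreover have "g C \<notin> HC C `` {v}" using gS[of C] HC(1)[of C] Pp(1)[of C] 3 by auto
        moreover have "finite (HC C `` {v})"
          using HC(1)[of C] finE 3 by (meson finite_Image finite_Int finite_subset)
        ultimately have "card (H `` {v}) = card (HC C `` {v}) + (if v = p C then 1 else 0)"
          by (cases "v = p C") auto
        then show ?thesis using HC(3)[OF 3] by simp
      qed
    qed
    ultimately show ?thesis by blast
  qed
qed

section \<open>Eigenfunctions of graphs\<close>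

lemma degree_of_eq: "degree_of G v = card (parcs G `` {v})"
proof -
  have "out_arcs (with_proj G) v = Pair v ` (parcs G `` {v})"
    by (auto simp: out_arcs_def)
  then show ?thesis by (simp add: out_degree_def card_image inj_on_def)
qed

lemma pair_graph_edges:
  assumes "pair_graph G"
  shows "finite (pverts G)" "parcs G \<subseteq> pverts G \<times> pverts G" "sym (parcs G)" "irrefl (parcs G)"
proof -
  interpret pair_graph G by fact
  show "finite (pverts G)" by (rule pair_finite_verts)
  show "parcs G \<subseteq> pverts G \<times> pverts G" using in_arcsD1 in_arcsD2 by auto
  show "sym (parcs G)" using arcs_symmetric by (auto simp: sym_def)
  show "irrefl (parcs G)" using no_loops' by (auto simp: irrefl_def)
qed

lemma pair_graphI:
  assumes "finite V" "E \<subseteq> V \<times> V" "sym E" "irrefl E"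
  shows "pair_graph \<lparr>pverts = V, parcs = E\<rparr>"
proof -
  have "finite E" using assms finite_subset by blast
  then show ?thesis
    using assms by unfold_locales (auto simp: symmetric_def irrefl_def)
qed

text \<open>The only form in which connectivity enters below. It is defined through reachability in
  the symmetric closure, which adds no arcs to a \<open>pair_graph\<close>.\<close>

lemma connected_closed:
  assumes "pair_graph G" "Digraph_Component.connected (with_proj G)"
    and "C \<subseteq> pverts G" "C \<noteq> {}" "parcs G `` C \<subseteq> C"
  shows "C = pverts G"
proof -
  interpret pair_graph G by fact
  have reach: "v \<in> C" if "u \<rightarrow>\<^sup>*\<^bsub>with_proj (mk_symmetric (with_proj G))\<^esub> v" "u \<in> C" for u v
    using that(2)
  proof (induction rule: rtrancl_on_induct[OF that(1)[unfolded reachable_def]])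
    case 1 then show ?case by simp
  next
    case (2 v w)
    then have "(v, w) \<in> parcs G"
      using arcs_symmetric by (auto simp: parcs_mk_symmetric)
    then show ?case using 2 assms(5) by auto
  qed
  obtain u where "u \<in> C" using assms(4) by blast
  then have "v \<in> C" if "v \<in> pverts G" for v
    using reach[of u v] assms(2,3) that
    by (auto simp: Digraph_Component.connected_def strongly_connected_def)
  then show ?thesis using assms(3) by auto
qed

text \<open>Indexing by vertices makes the enumeration behind the matrix disappear. The field is
  left open because existence of an eigenvalue is obtained over the complex numbers and then
  transferred to the reals.\<close>

definition eigenfunction :: "'a set \<Rightarrow> 'a rel \<Rightarrow> 'b::field \<Rightarrow> ('a \<Rightarrow> 'b) \<Rightarrow> bool" where
  "eigenfunction V E k x \<longleftrightarrow> (\<exists>v\<in>V. x v \<noteq> 0) \<and> (\<forall>v\<in>V. (\<Sum>u\<in>E `` {v}. x u) = k * x v)"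

lemma sum_neighbours:
  assumes "finite V" "E \<subseteq> V \<times> V"
  shows "(\<Sum>u\<in>E `` {v}. f u) = (\<Sum>u\<in>V. if (v, u) \<in> E then f u else 0)"
proof -
  have "E `` {v} = {u\<in>V. (v, u) \<in> E}" using assms(2) by auto
  then show ?thesis using assms(1) by (simp add: sum.inter_filter)
qed

lemma spectrum_adjacency:
  fixes k :: "'b::field"
  assumes bij: "bij_betw e {..<n} V" and EV: "E \<subseteq> V \<times> V"
  defines "A \<equiv> mat n n (\<lambda>(i, j). if (e i, e j) \<in> E then 1 else (0::'b))"
  shows "k \<in> spectrum A \<longleftrightarrow> (\<exists>x. eigenfunction V E k x)"
proof -
  have finV: "finite V" using bij bij_betw_finite by blast
  have A: "A \<in> carrier_mat n n" by (simp add: A_def)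
  have key: "(A *\<^sub>v w) $ i = (\<Sum>u\<in>E `` {e i}. x u)"
    if "i < n" "dim_vec w = n" "\<And>j. j < n \<Longrightarrow> w $ j = x (e j)" for w i and x :: "'a \<Rightarrow> 'b"
  proof -
    have "(A *\<^sub>v w) $ i = (\<Sum>j<n. A $$ (i, j) * w $ j)"
      using that(1,2) A by (simp add: scalar_prod_def atLeast0LessThan)
    also have "\<dots> = (\<Sum>j<n. if (e i, e j) \<in> E then x (e j) else 0)"
      using that by (intro sum.cong) (auto simp: A_def)
    also have "\<dots> = (\<Sum>u\<in>V. if (e i, u) \<in> E then x u else 0)"
      by (rule sum.reindex_bij_betw[OF bij])
    finally show ?thesis using sum_neighbours[OF finV EV] by metis
  qed
  have eV: "e i \<in> V" if "i < n" for i using bij that by (auto simp: bij_betw_def)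
  show ?thesis
  proof
    assume "k \<in> spectrum A"
    then obtain w where w: "dim_vec w = n" "w \<noteq> 0\<^sub>v n" "A *\<^sub>v w = k \<cdot>\<^sub>v w"
      using A by (auto simp: spectrum_def eigenvalue_def eigenvector_def dest: carrier_vecD)
    define x where "x v = w $ the_inv_into {..<n} e v" for v
    have x: "w $ j = x (e j)" if "j < n" for j
      using bij that by (simp add: x_def the_inv_into_f_f bij_betw_def)
    have "eigenfunction V E k x"
      unfolding eigenfunction_def
    proof (intro conjI ballI)
      obtain i where "i < n" "w $ i \<noteq> 0" using w(1,2) by (auto simp: vec_eq_iff)
      then show "\<exists>v\<in>V. x v \<noteq> 0" using x eV by metis
      fix v assume "v \<in> V"
      then obtain i where i: "i < n" "v = e i" using bij by (auto simp: bij_betw_def)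
      then show "(\<Sum>u\<in>E `` {v}. x u) = k * x v"
        using key[OF i(1) w(1) x] w x by simp
    qed
    then show "\<exists>x. eigenfunction V E k x" by blast
  next
    assume "\<exists>x. eigenfunction V E k x"
    then obtain x where x: "eigenfunction V E k x" by blast
    define w where "w = vec n (\<lambda>j. x (e j))"
    obtain v where "v \<in> V" "x v \<noteq> 0" using x by (auto simp: eigenfunction_def)
    moreover from this obtain i where "i < n" "v = e i" using bij by (auto simp: bij_betw_def)
    ultimately have "w \<noteq> 0\<^sub>v n" by (auto simp: w_def vec_eq_iff)
    moreover have "A *\<^sub>v w = k \<cdot>\<^sub>v w"
    proof (rule eq_vecI)
      fix i assume "i < dim_vec (k \<cdot>\<^sub>v w)"
      then have i: "i < n" by (simp add: w_def)
      have "(A *\<^sub>v w) $ i = (\<Sum>u\<in>E `` {e i}. x u)" using i by (intro key) (auto simp: w_def)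
      then show "(A *\<^sub>v w) $ i = (k \<cdot>\<^sub>v w) $ i"
        using x eV[OF i] i by (simp add: eigenfunction_def w_def)
    qed (use A in \<open>simp add: w_def\<close>)
    moreover have "w \<in> carrier_vec n" by (simp add: w_def)
    ultimately show "k \<in> spectrum A"
      using A by (auto simp: spectrum_def eigenvalue_def eigenvector_def)
  qed
qed

text \<open>Self-adjointness of the adjacency operator, in bilinear form; over the complex numbers
  the conjugate is put into \<open>a\<close>.\<close>

lemma sum_swap_neighbours:
  fixes a b :: "'a \<Rightarrow> 'b::comm_semiring_0"
  assumes "finite V" "E \<subseteq> V \<times> V" "sym E"
  shows "(\<Sum>v\<in>V. a v * (\<Sum>u\<in>E `` {v}. b u)) = (\<Sum>v\<in>V. b v * (\<Sum>u\<in>E `` {v}. a u))"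
proof -
  have "(\<Sum>v\<in>V. a v * (\<Sum>u\<in>E `` {v}. b u)) = (\<Sum>v\<in>V. \<Sum>u\<in>V. if (v, u) \<in> E then a v * b u else 0)"
    using assms by (simp add: sum_neighbours sum_distrib_left if_distrib cong: if_cong)
  also have "\<dots> = (\<Sum>u\<in>V. \<Sum>v\<in>V. if (v, u) \<in> E then a v * b u else 0)" by (rule sum.swap)
  also have "\<dots> = (\<Sum>u\<in>V. \<Sum>v\<in>V. if (u, v) \<in> E then b u * a v else 0)"
    using assms(3) by (intro sum.cong) (auto simp: mult.commute dest: symD)
  also have "\<dots> = (\<Sum>v\<in>V. b v * (\<Sum>u\<in>E `` {v}. a u))"
    using assms by (simp add: sum_neighbours sum_distrib_left if_distrib cong: if_cong)
  finally show ?thesis .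
qed

text \<open>By self-adjointness \<open>?Q = k * ?N\<close> equals its own conjugate while
  \<open>?N\<close> is real and nonzero, so \<open>k\<close> is real. Then the real and imaginary
  parts of \<open>x\<close> satisfy the equation separately, and one of them is not zero.\<close>

lemma eigenfunction_complex_real:
  fixes k :: complex
  assumes "finite V" "E \<subseteq> V \<times> V" "sym E" "eigenfunction V E k x"
  shows "\<exists>y. eigenfunction V E (Re k) y"
proof -
  let ?N = "\<Sum>v\<in>V. cnj (x v) * x v" and ?Q = "\<Sum>v\<in>V. cnj (x v) * (\<Sum>u\<in>E `` {v}. x u)"
  have ev: "(\<Sum>u\<in>E `` {v}. x u) = k * x v" if "v \<in> V" for v
    using assms(4) that by (simp add: eigenfunction_def)
  obtain v0 where v0: "v0 \<in> V" "x v0 \<noteq> 0" using assms(4) by (auto simp: eigenfunction_def)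
  have N: "?N = of_real (\<Sum>v\<in>V. (cmod (x v))\<^sup>2)"
    by (simp add: complex_norm_square mult.commute del: of_real_power)
  have "(\<Sum>v\<in>V. (cmod (x v))\<^sup>2) > 0"
    using assms(1) v0 by (intro sum_pos2[of _ v0]) auto
  then have N0: "?N \<noteq> 0" unfolding N by (metis less_irrefl of_real_eq_0_iff)
  have cN: "cnj ?N = ?N" unfolding N by (rule complex_cnj_complex_of_real)
  have "?Q = k * ?N" using ev by (simp add: sum_distrib_left mult.assoc mult.left_commute cong: sum.cong)
  moreover have "cnj ?Q = ?Q"
    using sum_swap_neighbours[OF assms(1-3), of "\<lambda>v. cnj (x v)" x] by simp
  ultimately have "cnj k * ?N = k * ?N" using cN by (metis complex_cnj_mult)
  then have "cnj k = k" using N0 by simp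
  then have k: "k = of_real (Re k)" by (metis Reals_cnj_iff of_real_Re)
  have Im: "Im k = 0" by (subst k) simp
  have "(\<Sum>u\<in>E `` {v}. Re (x u)) = Re k * Re (x v)" "(\<Sum>u\<in>E `` {v}. Im (x u)) = Re k * Im (x v)"
    if "v \<in> V" for v
    using arg_cong[OF ev[OF that], of Re] arg_cong[OF ev[OF that], of Im] Im by simp_all
  moreover have "Re (x v0) \<noteq> 0 \<or> Im (x v0) \<noteq> 0" using v0(2) complex_eqI by fastforce
  ultimately have "eigenfunction V E (Re k) (\<lambda>v. Re (x v)) \<or> eigenfunction V E (Re k) (\<lambda>v. Im (x v))"
    using v0(1) by (auto simp: eigenfunction_def)
  then show ?thesis by blast
qed

text \<open>\<open>Max\<close> says something only about a finite nonempty set. Nonemptiness of the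
  real spectrum comes from a complex eigenvalue, which symmetry forces to be real.\<close>

lemma graph_spectral_radius:
  assumes "finite (pverts G)" "parcs G \<subseteq> pverts G \<times> pverts G"
  shows graph_spectral_radius_ge: "eigenfunction (pverts G) (parcs G) k x \<Longrightarrow> k \<le> graph_spectral_radius G"
    and graph_spectral_radius_eigenfunction: "sym (parcs G) \<Longrightarrow> pverts G \<noteq> {} \<Longrightarrow>
      \<exists>x. eigenfunction (pverts G) (parcs G) (graph_spectral_radius G) x"
proof -
  let ?n = "card (pverts G)" and ?e = "from_nat_into (pverts G)"
  let ?A = "adjacency_mat G"
  have bij: "bij_betw ?e {..<?n} (pverts G)"
    using bij_betw_from_nat_into_finite[OF assms(1)] .
  note spec = spectrum_adjacency[OF bij assms(2)]
  have A: "?A \<in> carrier_mat ?n ?n" by (simp add: adjacency_mat_def)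
  have fin: "finite (spectrum ?A)" by (rule card_finite_spectrum[OF A])
  show "k \<le> graph_spectral_radius G" if "eigenfunction (pverts G) (parcs G) k x"
    unfolding graph_spectral_radius_def using fin spec[of k] that
    by (intro Max_ge) (auto simp: adjacency_mat_def)
  assume *: "sym (parcs G)" "pverts G \<noteq> {}"
  let ?B = "mat ?n ?n (\<lambda>(i, j). if (?e i, ?e j) \<in> parcs G then 1 else (0::complex))"
  have "spectrum ?B \<noteq> {}"
    using *(2) assms(1) by (intro spectrum_non_empty[of _ ?n]) auto
  then obtain k :: complex and x where "eigenfunction (pverts G) (parcs G) k x"
    using spec by blast
  then have "Re k \<in> spectrum ?A"
    using eigenfunction_complex_real[OF assms *(1)] spec[of "Re k"] by (auto simp: adjacency_mat_def)
  then have "graph_spectral_radius G \<in> spectrum ?A"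
    unfolding graph_spectral_radius_def using fin by (intro Max_in) auto
  then show "\<exists>x. eigenfunction (pverts G) (parcs G) (graph_spectral_radius G) x"
    using spec[of "graph_spectral_radius G"] by (simp add: adjacency_mat_def)
qed

text \<open>
  For an eigenfunction \<open>x\<close> and a positive \<open>z\<close>, both \<open>\<Sum>v. \<bar>x v\<bar> * (c * z v - (A z) v)\<close> and
  \<open>\<Sum>v. z v * ((A \<bar>x\<bar>) v - k * \<bar>x v\<bar>)\<close> have nonnegative terms, and they add up to
  \<open>(c - k) * (\<Sum>v. \<bar>x v\<bar> * z v)\<close>.
\<close>

lemma eigenvalue_le_test_function:
  fixes x z :: "'a \<Rightarrow> real"
  assumes "finite V" "E \<subseteq> V \<times> V" "sym E" "eigenfunction V E k x"
    and z: "\<And>v. v \<in> V \<Longrightarrow> z v > 0" "\<And>v. v \<in> V \<Longrightarrow> (\<Sum>u\<in>E `` {v}. z u) \<le> c * z v"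
  shows eigenvalue_le: "k \<le> c"
    and eigenvalue_eq: "k = c \<Longrightarrow> (\<And>C. C \<subseteq> V \<Longrightarrow> C \<noteq> {} \<Longrightarrow> E `` C \<subseteq> C \<Longrightarrow> C = V) \<Longrightarrow>
      v \<in> V \<Longrightarrow> (\<Sum>u\<in>E `` {v}. z u) = c * z v"
proof -
  define a where "a v = \<bar>x v\<bar> * (c * z v - (\<Sum>u\<in>E `` {v}. z u))" for v
  define b where "b v = z v * ((\<Sum>u\<in>E `` {v}. \<bar>x u\<bar>) - k * \<bar>x v\<bar>)" for v
  obtain v0 where v0: "v0 \<in> V" "x v0 \<noteq> 0" using assms(4) by (auto simp: eigenfunction_def)
  have W: "(\<Sum>v\<in>V. \<bar>x v\<bar> * z v) > 0"
    using assms(1) v0 z(1) by (intro sum_pos2[of _ v0]) (auto simp: less_imp_le)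
  have a0: "a v \<ge> 0" if "v \<in> V" for v using z(2)[OF that] by (simp add: a_def)
  have b0: "b v \<ge> 0" if "v \<in> V" for v
  proof -
    have "k * \<bar>x v\<bar> \<le> \<bar>k * x v\<bar>" by (simp add: abs_mult mult_right_mono)
    also have "k * x v = (\<Sum>u\<in>E `` {v}. x u)" using assms(4) that by (simp add: eigenfunction_def)
    also have "\<bar>\<dots>\<bar> \<le> (\<Sum>u\<in>E `` {v}. \<bar>x u\<bar>)" by (rule sum_abs)
    finally show ?thesis using z(1)[OF that] by (simp add: b_def)
  qed
  have "(\<Sum>v\<in>V. a v) + (\<Sum>v\<in>V. b v) = (\<Sum>v\<in>V. \<bar>x v\<bar> * (c * z v)) - (\<Sum>v\<in>V. z v * (k * \<bar>x v\<bar>))"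
    using sum_swap_neighbours[OF assms(1-3), of "\<lambda>v. \<bar>x v\<bar>" z]
    by (simp add: a_def b_def right_diff_distrib sum_subtractf)
  also have "\<dots> = (c - k) * (\<Sum>v\<in>V. \<bar>x v\<bar> * z v)"
    by (simp add: sum_distrib_left sum_subtractf algebra_simps)
  finally have total: "(\<Sum>v\<in>V. a v) + (\<Sum>v\<in>V. b v) = (c - k) * (\<Sum>v\<in>V. \<bar>x v\<bar> * z v)" .
  have a_nn: "(\<Sum>v\<in>V. a v) \<ge> 0" and b_nn: "(\<Sum>v\<in>V. b v) \<ge> 0"
    using a0 b0 by (auto intro: sum_nonneg)
  show "k \<le> c"
  proof (rule ccontr)
    assume "\<not> k \<le> c"
    then have "(c - k) * (\<Sum>v\<in>V. \<bar>x v\<bar> * z v) < 0" using W by (simp add: mult_neg_pos)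
    then show False using total a_nn b_nn by linarith
  qed
  assume kc: "k = c" and conn: "\<And>C. C \<subseteq> V \<Longrightarrow> C \<noteq> {} \<Longrightarrow> E `` C \<subseteq> C \<Longrightarrow> C = V" and v: "v \<in> V"
  have sums0: "(\<Sum>v\<in>V. a v) = 0" "(\<Sum>v\<in>V. b v) = 0" using total a_nn b_nn kc by auto
  have a_zero: "a v = 0" and b_zero: "b v = 0" if "v \<in> V" for v
    using sums0 a0 b0 that assms(1) by (simp_all add: sum_nonneg_eq_0_iff)
  \<comment> \<open>In the equality case all \<open>b v\<close> vanish, so the zeros of
    \<open>x\<close> are closed under neighbours; connectivity leaves no zeros, and
    \<open>a v = 0\<close> then gives the equation for \<open>z\<close> at every vertex.\<close>
  define C where "C = {v\<in>V. x v = 0}"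
  have "E `` C \<subseteq> C"
  proof
    fix u assume "u \<in> E `` C"
    then obtain w where w: "w \<in> V" "x w = 0" "u \<in> E `` {w}" by (auto simp: C_def)
    have finE: "finite (E `` {w})" using assms(1,2) by (auto intro: finite_subset[of _ V])
    have "(\<Sum>u\<in>E `` {w}. \<bar>x u\<bar>) = 0" using b_zero[OF w(1)] z(1)[OF w(1)] w(2) by (simp add: b_def)
    then have "x u = 0" using w(3) finE by (simp add: sum_nonneg_eq_0_iff)
    then show "u \<in> C" using w(3) assms(2) by (auto simp: C_def)
  qed
  then have "C = {}" using conn[of C] v0 by (auto simp: C_def)
  then have "x v \<noteq> 0" using v by (auto simp: C_def)
  then show "(\<Sum>u\<in>E `` {v}. z u) = c * z v" using a_zero[OF v] by (simp add: a_def)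
qed

section \<open>Spectral bounds for joins with disjoint cliques\<close>

text \<open>The first two terms on the left are the chord of
  \<open>t / (K - t) = K / (K - t) - 1\<close> through \<open>t = p\<close> and
  \<open>t = M\<close>. For positive \<open>K\<close> the difference vanishes only at these two
  points, which later determines the clique orders in the equality case.\<close>

lemma quotient_chord:
  fixes t p M K :: real
  assumes "p \<le> t" "t \<le> M" "M < K"
  shows "K * (K - p - M + t) / ((K - p) * (K - M)) - 1 - t / (K - t) =
         K * ((t - p) * (M - t)) / ((K - t) * (K - p) * (K - M))"
proof -
  have "K - t \<noteq> 0" "K - p \<noteq> 0" "K - M \<noteq> 0" using assms by auto
  then show ?thesis by (simp add: divide_simps) (simp add: algebra_simps)
qed

text \<open>
  Convexity of \<open>t / (K - t)\<close>: for a given total, the sum is largest when all parts but one have the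
  least admissible size, and additional parts only decrease it.
\<close>

lemma sum_quotient_le_extreme:
  fixes t :: "'x \<Rightarrow> real" and p M K :: real and q :: nat
  assumes "finite P" "q \<ge> 1" "q \<le> card P" "0 < p" "p \<le> M" "M < K"
    and ge: "\<And>C. C \<in> P \<Longrightarrow> p \<le> t C" and total: "(\<Sum>C\<in>P. t C) = M + (real q - 1) * p"
  shows sum_quotient_part_le: "C \<in> P \<Longrightarrow> t C \<le> M"
    and sum_quotient_le: "(\<Sum>C\<in>P. t C / (K - t C)) \<le> (real q - 1) * p / (K - p) + M / (K - M)"
    and sum_quotient_eq: "(\<Sum>C\<in>P. t C / (K - t C)) = (real q - 1) * p / (K - p) + M / (K - M) \<Longrightarrow>
      card P = q \<and> (\<forall>C\<in>P. t C = p \<or> t C = M)"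
proof -
  show le: "t C \<le> M" if "C \<in> P" for C
  proof -
    have "real (card (P - {C})) * p \<le> (\<Sum>D\<in>P - {C}. t D)"
      using ge by (intro sum_bounded_below) auto
    moreover have "real (card (P - {C})) \<ge> real q - 1"
      using assms(1,2,3) that by simp
    then have "real (card (P - {C})) * p \<ge> (real q - 1) * p"
      using assms(4) by (simp add: mult_right_mono)
    ultimately show ?thesis using total assms(1) that by (simp add: sum.remove)
  qed
  define D where "D = (K - p) * (K - M)"
  define gap where "gap C = K * ((t C - p) * (M - t C)) / ((K - t C) * (K - p) * (K - M))" for C
  have D: "D > 0" using assms by (simp add: D_def)
  have gap0: "gap C \<ge> 0" if "C \<in> P" for C
    using ge[OF that] le[OF that] assms by (simp add: gap_def)
  have chord: "t C / (K - t C) = (K * (K - p - M) / D - 1) + K / D * t C - gap C" if "C \<in> P" for C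
    using quotient_chord[OF ge[OF that] le[OF that] assms(6)]
    by (simp add: gap_def D_def distrib_left add_divide_distrib)
  \<comment> \<open>The chord has negative intercept \<open>- (p * M / D)\<close>; with the total
    fixed, every part beyond \<open>q\<close> therefore lowers the sum by
    \<open>p * M / D\<close>.\<close>
  have coeff: "K * (K - p - M) / D - 1 = - (p * M / D)"
  proof -
    have "K * (K - p - M) - D = - (p * M)" by (simp add: D_def algebra_simps)
    moreover have "K * (K - p - M) / D - 1 = (K * (K - p - M) - D) / D"
      using D by (simp add: diff_divide_distrib)
    ultimately show ?thesis by simp
  qed
  have "(\<Sum>C\<in>P. t C / (K - t C)) =
      real (card P) * (K * (K - p - M) / D - 1) + K / D * (\<Sum>C\<in>P. t C) - (\<Sum>C\<in>P. gap C)"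
    using chord by (simp add: sum.distrib sum_subtractf sum_distrib_left)
  also have "\<dots> = real q * (K * (K - p - M) / D - 1) + K / D * (M + (real q - 1) * p)
      - (real (card P) - real q) * (p * M / D) - (\<Sum>C\<in>P. gap C)"
    unfolding total coeff by (simp add: algebra_simps)
  also have "real q * (K * (K - p - M) / D - 1) + K / D * (M + (real q - 1) * p) =
      (real q - 1) * p / (K - p) + M / (K - M)"
  proof -
    have "K - p \<noteq> 0" "K - M \<noteq> 0" using assms by auto
    then show ?thesis unfolding D_def by (simp add: divide_simps) (simp add: algebra_simps)
  qed
  finally have main: "(\<Sum>C\<in>P. t C / (K - t C)) = (real q - 1) * p / (K - p) + M / (K - M)
      - (real (card P) - real q) * (p * M / D) - (\<Sum>C\<in>P. gap C)" .
  have pM: "p * M / D > 0" using assms D by simp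
  have nn: "(real (card P) - real q) * (p * M / D) \<ge> 0" "(\<Sum>C\<in>P. gap C) \<ge> 0"
  proof -
    show "(real (card P) - real q) * (p * M / D) \<ge> 0"
      using assms(3) pM by (intro mult_nonneg_nonneg) simp_all
    show "(\<Sum>C\<in>P. gap C) \<ge> 0" using gap0 by (rule sum_nonneg)
  qed
  show "(\<Sum>C\<in>P. t C / (K - t C)) \<le> (real q - 1) * p / (K - p) + M / (K - M)"
    using main nn by linarith
  assume "(\<Sum>C\<in>P. t C / (K - t C)) = (real q - 1) * p / (K - p) + M / (K - M)"
  then have z: "(real (card P) - real q) * (p * M / D) = 0" "(\<Sum>C\<in>P. gap C) = 0"
    using main nn by linarith+
  have "t C = p \<or> t C = M" if "C \<in> P" for C
  proof -
    have "gap C = 0" using z(2) gap0 assms(1) that by (simp add: sum_nonneg_eq_0_iff)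
    then show ?thesis using le[OF that] assms by (auto simp: gap_def)
  qed
  then show "card P = q \<and> (\<forall>C\<in>P. t C = p \<or> t C = M)" using z(1) pM by auto
qed

text \<open>
  The test function is \<open>1\<close> on \<open>S\<close> and \<open>card S / (K - card C)\<close> on the part \<open>C\<close>: this is the eigenfunction,
  for the eigenvalue \<open>K - 1\<close>, of the join of \<open>S\<close> with disjoint cliques on the parts.
\<close>

lemma join_test_function:
  fixes K :: real
  assumes "finite V" "E \<subseteq> V \<times> V" "irrefl E" "S \<subseteq> V" "S \<noteq> {}"
    and P: "pairwise disjnt P" "\<Union>P = V - S" "\<forall>C\<in>P. E `` C \<subseteq> C \<union> S"
    and K: "\<forall>C\<in>P. real (card C) < K"
    and bound: "card S * (\<Sum>C\<in>P. card C / (K - card C)) \<le> K - card S"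
  shows "\<exists>z. (\<forall>v\<in>V. z v > 0) \<and> (\<forall>v\<in>V. (\<Sum>u\<in>E `` {v}. z u) \<le> (K - 1) * z v) \<and>
     ((\<forall>v\<in>V. (\<Sum>u\<in>E `` {v}. z u) = (K - 1) * z v) \<longrightarrow>
       card S * (\<Sum>C\<in>P. card C / (K - card C)) = K - card S \<and>
       (\<forall>v\<in>S. E `` {v} = V - {v}) \<and> (\<forall>C\<in>P. \<forall>v\<in>C. E `` {v} = (C - {v}) \<union> S))"
proof -
  have "\<forall>v\<in>V - S. \<exists>C. C \<in> P \<and> v \<in> C" using P(2) by blast
  from bchoice[OF this] obtain part where part: "\<And>v. v \<in> V - S \<Longrightarrow> part v \<in> P \<and> v \<in> part v"
    by blast
  have CV: "C \<subseteq> V - S" if "C \<in> P" for C using P(2) that by blast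
  have part_eq: "part v = C" if "C \<in> P" "v \<in> C" for C v
  proof -
    have "part v \<in> P" "v \<in> part v" using part[of v] CV[OF that(1)] that(2) by auto
    then show ?thesis using P(1) that unfolding pairwise_def disjnt_def by blast
  qed
  define z where "z v = (if v \<in> S then 1 else card S / (K - card (part v)))" for v
  have finS: "finite S" using assms(1,4) finite_subset by blast
  have finC: "finite C" if "C \<in> P" for C using CV[OF that] assms(1) finite_subset by blast
  have s: "real (card S) > 0" using finS assms(5) by (simp add: card_gt_0_iff)
  have zC: "z v = card S / (K - card C)" if "C \<in> P" "v \<in> C" for C v
    using part_eq[OF that] CV[OF that(1)] that(2) by (auto simp: z_def)
  have pos: "z v > 0" if "v \<in> V" for v
    using part[of v] bspec[OF K, of "part v"] s that by (auto simp: z_def)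
  have big_C: "(\<Sum>u\<in>(C - {v}) \<union> S. z u) = (K - 1) * z v" if "C \<in> P" "v \<in> C" for C v
  proof -
    have "(\<Sum>u\<in>(C - {v}) \<union> S. z u) = (\<Sum>u\<in>C - {v}. z u) + (\<Sum>u\<in>S. z u)"
      using CV[OF that(1)] finS finC[OF that(1)] by (intro sum.union_disjoint) auto
    also have "(\<Sum>u\<in>S. z u) = card S" by (simp add: z_def)
    also have "(\<Sum>u\<in>C - {v}. z u) = (\<Sum>u\<in>C - {v}. card S / (K - card C))"
      using zC[OF that(1)] by (intro sum.cong) auto
    also have "\<dots> = (real (card C) - 1) * z v"
    proof -
      have "card C > 0" using that(2) finC[OF that(1)] by (auto simp: card_gt_0_iff)
      then have "real (card (C - {v})) = real (card C) - 1"
        using that(2) by (simp add: of_nat_diff)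
      then show ?thesis using zC[OF that] by simp
    qed
    also have "(real (card C) - 1) * z v + real (card S) = (K - 1) * z v"
      using zC[OF that] bspec[OF K that(1)] by (simp add: field_simps)
    finally show ?thesis .
  qed
  \<comment> \<open>On the parts the eigenvalue equation of the full join holds for every admissible
    \<open>K\<close>. The vertices of \<open>S\<close> give the only condition on \<open>K\<close>,
    which is \<open>bound\<close>.\<close>
  have big_S: "(\<Sum>u\<in>V - {v}. z u) =
      real (card S) - 1 + card S * (\<Sum>C\<in>P. card C / (K - card C))" if "v \<in> S" for v
  proof -
    have "V - {v} = (S - {v}) \<union> \<Union>P" using P(2) assms(4) that by auto
    then have "(\<Sum>u\<in>V - {v}. z u) = (\<Sum>u\<in>S - {v}. z u) + (\<Sum>u\<in>\<Union>P. z u)"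
      using P(2) assms(1) finS by (simp only:, intro sum.union_disjoint) auto
    also have "(\<Sum>u\<in>S - {v}. z u) = real (card S) - 1"
    proof -
      have "(\<Sum>u\<in>S - {v}. z u) = real (card (S - {v}))" by (simp add: z_def)
      moreover have "card S \<ge> 1" using s by linarith
      ultimately show ?thesis using that finS by (simp add: of_nat_diff)
    qed
    also have "(\<Sum>u\<in>\<Union>P. z u) = (\<Sum>C\<in>P. \<Sum>u\<in>C. z u)"
      using P(1) finC by (subst sum.Union_disjoint) (auto simp: pairwise_def disjnt_def)
    also have "\<dots> = (\<Sum>C\<in>P. card S * (card C / (K - card C)))"
      using zC by (intro sum.cong) auto
    finally show ?thesis
      by (simp add: sum_distrib_left)
  qed
  have nb_C: "E `` {v} \<subseteq> (C - {v}) \<union> S" if "C \<in> P" "v \<in> C" for C v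
    using bspec[OF P(3) that(1)] that(2) assms(3) by (auto simp: irrefl_def)
  have nb_S: "E `` {v} \<subseteq> V - {v}" for v
    using assms(2,3) by (auto simp: irrefl_def)
  \<comment> \<open>Positivity of \<open>z\<close> turns equality of neighbourhood sums into
    equality of neighbourhoods.\<close>
  have full: "A = B" if AB: "A \<subseteq> B" "B \<subseteq> V" "(\<Sum>u\<in>B. z u) \<le> (\<Sum>u\<in>A. z u)" for A B
  proof (rule ccontr)
    assume "A \<noteq> B"
    then obtain u where "u \<in> B - A" using AB(1) by blast
    moreover have "finite B" using AB(2) assms(1) finite_subset by blast
    ultimately have "(\<Sum>u\<in>A. z u) < (\<Sum>u\<in>B. z u)"
      using AB(1,2) pos by (intro sum_strict_mono2[of B A u]) (auto intro: less_imp_le)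
    then show False using AB(3) by simp
  qed
  have mono: "(\<Sum>u\<in>A. z u) \<le> (\<Sum>u\<in>B. z u)" if "A \<subseteq> B" "B \<subseteq> V" for A B
    using that assms(1) pos by (intro sum_mono2) (auto intro: finite_subset less_imp_le)
  have CS: "(C - {v}) \<union> S \<subseteq> V" if "C \<in> P" for C v using CV[OF that] assms(4) by auto
  have zS: "z v = 1" if "v \<in> S" for v using that by (simp add: z_def)
  have le: "(\<Sum>u\<in>E `` {v}. z u) \<le> (K - 1) * z v" if v: "v \<in> V" for v
  proof (cases "v \<in> S")
    case True
    have "(\<Sum>u\<in>E `` {v}. z u) \<le> (\<Sum>u\<in>V - {v}. z u)" using nb_S by (intro mono) auto
    then show ?thesis using big_S[OF True] bound zS[OF True] by simp
  next
    case False
    then have C: "part v \<in> P" "v \<in> part v" using part v by auto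
    show ?thesis using mono[OF nb_C[OF C] CS[OF C(1)]] big_C[OF C] by simp
  qed
  have rigid: "card S * (\<Sum>C\<in>P. card C / (K - card C)) = K - card S \<and>
       (\<forall>v\<in>S. E `` {v} = V - {v}) \<and> (\<forall>C\<in>P. \<forall>v\<in>C. E `` {v} = (C - {v}) \<union> S)"
    if eq: "\<forall>v\<in>V. (\<Sum>u\<in>E `` {v}. z u) = (K - 1) * z v"
  proof (intro conjI ballI)
    obtain v where v: "v \<in> S" using assms(5) by blast
    have "K - 1 \<le> real (card S) - 1 + card S * (\<Sum>C\<in>P. card C / (K - card C))" if "v \<in> S" for v
    proof -
      have "K - 1 = (\<Sum>u\<in>E `` {v}. z u)" using eq assms(4) that zS by auto
      also have "\<dots> \<le> (\<Sum>u\<in>V - {v}. z u)" using nb_S by (intro mono) auto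
      finally show ?thesis using big_S[OF that] by simp
    qed
    from this[OF v] show sum_eq: "card S * (\<Sum>C\<in>P. card C / (K - card C)) = K - card S"
      using bound by simp
    show "E `` {v} = V - {v}" if "v \<in> S" for v
    proof (rule full[OF nb_S])
      have "(\<Sum>u\<in>E `` {v}. z u) = K - 1" using eq assms(4) that zS by auto
      then show "(\<Sum>u\<in>V - {v}. z u) \<le> (\<Sum>u\<in>E `` {v}. z u)"
        using big_S[OF that] sum_eq by simp
    qed auto
    show "E `` {v} = (C - {v}) \<union> S" if "C \<in> P" "v \<in> C" for C v
    proof (rule full[OF nb_C[OF that] CS[OF that(1)]])
      have "v \<in> V" using CV that by blast
      then show "(\<Sum>u\<in>(C - {v}) \<union> S. z u) \<le> (\<Sum>u\<in>E `` {v}. z u)"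
        using big_C[OF that] eq by simp
    qed
  qed
  show ?thesis
  proof (rule exI[where x = z], intro conjI ballI impI)
    show "z v > 0" if "v \<in> V" for v by (rule pos[OF that])
    show "(\<Sum>u\<in>E `` {v}. z u) \<le> (K - 1) * z v" if "v \<in> V" for v by (rule le[OF that])
    assume eq: "\<forall>v\<in>V. (\<Sum>u\<in>E `` {v}. z u) = (K - 1) * z v"
    show "card S * (\<Sum>C\<in>P. card C / (K - card C)) = K - card S"
      by (rule conjunct1[OF rigid[OF eq]])
    show "E `` {v} = V - {v}" if "v \<in> S" for v
      using rigid[OF eq] that by (elim conjE) (rule bspec)
    show "E `` {v} = (C - {v}) \<union> S" if "C \<in> P" "v \<in> C" for C v
      using bspec[OF bspec[OF conjunct2[OF conjunct2[OF rigid[OF eq]]] that(1)] that(2)] .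
  qed
qed

text \<open>
  With \<open>K - 1 = n - b * \<delta> - 2\<close>, a lower bound for the spectral radius of the extremal graph, \<open>e\<close> is the
  amount by which the largest clique \<open>S \<union> C\<close> falls short of its size \<open>K\<close> in the extremal graph.
\<close>

lemma extremal_bound_of_surplus:
  fixes s e M K p q :: real
  assumes "K = M + s + e" "s > 0" "e > 0" "p < K"
    and "s * (q * p) * (s + e) \<le> e * (K * (K - p))"
  shows "s * (q * p / (K - p) + M / (K - M)) \<le> K - s"
proof -
  have KM: "K - M = s + e" and pos: "s + e > 0" "K - p > 0" using assms by auto
  have "s * (q * p / (K - p)) \<le> e * K / (s + e)"
    using assms(5) pos by (simp add: divide_simps mult_ac)
  also have "e * K / (s + e) = K - s - s * (M / (K - M))"
    unfolding KM using pos(1) by (simp add: assms(1) field_simps)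
  finally show ?thesis by (simp add: distrib_left)
qed

section \<open>Arithmetic of the order bound\<close>

text \<open>With \<open>s = \<delta> + d\<close> this is \<open>s * (s + 1) \<le> d * K\<close>.
  Each lower bound on \<open>K\<close> serves one range of \<open>d\<close>: the one growing with
  \<open>d\<close> for \<open>d \<ge> 2 * \<delta>\<close>, the linear one in the middle, the cubic
  one for \<open>3 * d \<le> \<delta>\<close>.\<close>

lemma surplus_aux:
  fixes \<delta> d K :: nat
  assumes "d \<ge> 1" "K \<ge> \<delta> + 2 * d + 1" "K \<ge> 7 * \<delta> + 3" "K + 1 \<ge> \<delta> ^ 3"
  shows "(\<delta> + d) * (\<delta> + d + 1) \<le> d * K"
proof -
  consider "d \<ge> 2 * \<delta>" | "d < 2 * \<delta>" "3 * d \<ge> \<delta> + 1" | "3 * d \<le> \<delta>" by linarith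
  then show ?thesis
  proof cases
    case 1
    have "\<delta> * \<delta> + \<delta> * d + \<delta> \<le> d * d"
    proof (cases "\<delta> = 0")
      case False
      have "\<delta> * \<delta> + \<delta> \<le> \<delta> * (2 * \<delta>)" using False by (cases \<delta>) auto
      also have "\<dots> \<le> \<delta> * d" using 1 by (intro mult_left_mono) auto
      finally have "\<delta> * \<delta> + \<delta> * d + \<delta> \<le> 2 * \<delta> * d" by simp
      also have "\<dots> \<le> d * d" using 1 by (intro mult_right_mono) auto
      finally show ?thesis .
    qed simp
    then have "(\<delta> + d) * (\<delta> + d + 1) \<le> d * (\<delta> + 2 * d + 1)" by (simp add: algebra_simps)
    also have "\<dots> \<le> d * K" using assms(2) by (intro mult_left_mono) auto
    finally show ?thesis .
  next
    case 2
    have "d * d \<le> 2 * \<delta> * d" using 2(1) by (intro mult_right_mono) auto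
    moreover have "\<delta> * (\<delta> + 1) \<le> \<delta> * (3 * d)" using 2(2) by (intro mult_left_mono) auto
    moreover have "(\<delta> + d) * (\<delta> + d + 1) = \<delta> * (\<delta> + 1) + d * d + 2 * \<delta> * d + d"
      by (simp add: algebra_simps)
    ultimately have "(\<delta> + d) * (\<delta> + d + 1) \<le> \<delta> * (3 * d) + 2 * \<delta> * d + 2 * \<delta> * d + d"
      by linarith
    also have "\<dots> \<le> d * (7 * \<delta> + 3)" by (simp add: algebra_simps)
    finally have "(\<delta> + d) * (\<delta> + d + 1) \<le> d * (7 * \<delta> + 3)" .
    also have "\<dots> \<le> d * K" using assms(3) by (intro mult_left_mono) auto
    finally show ?thesis .
  next
    case 3
    have \<delta>: "\<delta> \<ge> 3" using 3 assms(1) by simp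
    have "9 * ((\<delta> + d) * (\<delta> + d + 1)) = (3 * (\<delta> + d)) * (3 * (\<delta> + d + 1))"
      by (simp add: algebra_simps)
    also have "\<dots> \<le> (4 * \<delta>) * (4 * \<delta> + 3)" by (rule mult_le_mono) (use 3 in simp_all)
    also have "\<dots> + 9 \<le> 9 * \<delta> ^ 3"
    proof -
      have "3 * \<delta> \<le> \<delta> * \<delta>" using \<delta> by (intro mult_right_mono) auto
      moreover have "3 * (\<delta> * \<delta>) \<le> \<delta> * (\<delta> * \<delta>)" using \<delta> by (intro mult_right_mono) auto
      moreover have "(4 * \<delta>) * (4 * \<delta> + 3) = 16 * (\<delta> * \<delta>) + 12 * \<delta>"
        "\<delta> ^ 3 = \<delta> * (\<delta> * \<delta>)"
        by (simp_all add: power3_eq_cube algebra_simps)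
      ultimately show ?thesis using \<delta> by linarith
    qed
    also have "\<dots> \<le> 9 * K + 9" using assms(4) by simp
    finally have "9 * ((\<delta> + d) * (\<delta> + d + 1)) + 9 \<le> 9 * K + 9" by simp
    then have "(\<delta> + d) * (\<delta> + d + 1) \<le> 1 * K" by linarith
    also have "\<dots> \<le> d * K" using assms(1) by (intro mult_right_mono) auto
    finally show ?thesis .
  qed
qed

text \<open>\<open>K\<close> is the order of the largest clique of the extremal graph. The factor 7
  is 4 + 3, since \<open>n - b * \<delta>\<close> retains
  \<open>3 * (b * \<delta>) \<ge> 3 * \<delta>\<close>. The last bound follows from the third
  because \<open>\<delta> \<le> \<delta> ^ 3\<close> absorbs the remaining \<open>b - 1\<close>
  copies.\<close>

lemma order_bound_consequences:
  fixes b \<delta> n :: nat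
  assumes "b \<ge> 1" "n \<ge> order_bound b \<delta>"
  defines "K \<equiv> n - b * \<delta> - 1"
  shows "K \<ge> 7 * \<delta> + 3" "n = K + b * \<delta> + 1" "K + 1 + b * \<delta> \<ge> b * \<delta> ^ 3 + \<delta>" "K + 1 \<ge> \<delta> ^ 3"
proof -
  have n: "n \<ge> 4 * (b * \<delta>) + 4 * \<delta> + 4" "n \<ge> b * \<delta> ^ 3 + \<delta>"
    using assms(2) by (auto simp: order_bound_def algebra_simps)
  have "\<delta> \<le> b * \<delta>" using assms(1) by simp
  then show K: "K \<ge> 7 * \<delta> + 3" using n(1) unfolding K_def by linarith
  show nK: "n = K + b * \<delta> + 1" using n(1) unfolding K_def by linarith
  then show K3: "K + 1 + b * \<delta> \<ge> b * \<delta> ^ 3 + \<delta>" using n(2) by simp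
  have "\<delta> \<le> \<delta> ^ 3" by (cases \<delta>) (simp_all add: power3_eq_cube)
  then have "(b - 1) * \<delta> \<le> (b - 1) * \<delta> ^ 3" by (intro mult_left_mono) auto
  moreover have "b * \<delta> ^ 3 = (b - 1) * \<delta> ^ 3 + \<delta> ^ 3" "b * \<delta> = (b - 1) * \<delta> + \<delta>"
    using assms(1) by (cases b; simp)+
  ultimately show "K + 1 \<ge> \<delta> ^ 3" using K3 by linarith
qed

text \<open>The hypothesis of \<open>extremal_bound_of_surplus\<close> for
  \<open>card S = s > \<delta>\<close>, with \<open>p = 1\<close> and \<open>q = b * s + 1\<close>.
  The large clique together with \<open>S\<close> has \<open>n - b * s - 1 = K - b * d\<close>
  vertices, hence \<open>e = b * d\<close>. The product splits into
  \<open>s * (b * s + 1) \<le> b * d * K\<close> and \<open>s + b * d \<le> K - 1\<close>.\<close>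

lemma surplus_large:
  fixes b \<delta> n s d K :: nat
  assumes "b \<ge> 1" "n \<ge> order_bound b \<delta>" "d \<ge> 1" "s = \<delta> + d" "n \<ge> (b + 1) * s + 2" "n = K + b * \<delta> + 1"
  shows "s * (b * s + 1) * (s + b * d) \<le> b * d * (K * (K - 1))"
proof -
  have Keq: "n - b * \<delta> - 1 = K" using assms(6) by simp
  note c = order_bound_consequences[OF assms(1,2), unfolded Keq]
  have K: "K \<ge> s + b * d + 1" using assms(4-6) by (simp add: algebra_simps)
  moreover have "d \<le> b * d" using assms(1) by simp
  ultimately have "K \<ge> \<delta> + 2 * d + 1" using assms(4) by linarith
  then have "s * (s + 1) \<le> d * K" using surplus_aux[OF assms(3) _ c(1,4)] assms(4) by simp
  then have "b * (s * (s + 1)) \<le> b * (d * K)" by (rule mult_left_mono) simp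
  moreover have "s * (b * s + 1) \<le> b * (s * (s + 1))" using assms(1) by (simp add: algebra_simps)
  ultimately have "s * (b * s + 1) \<le> b * d * K" by (metis le_trans mult.assoc)
  then have "s * (b * s + 1) * (s + b * d) \<le> (b * d * K) * (K - 1)"
    by (rule mult_le_mono) (use K in simp)
  then show ?thesis by (simp add: mult.assoc)
qed

text \<open>The same hypothesis for \<open>card S = s < \<delta>\<close>, where parts have order at
  least \<open>p = t + 1\<close>; solving \<open>n + e = K + (b * s + 1) * p\<close> for
  \<open>e\<close> gives the expression here. Since \<open>e \<ge> 1\<close>,
  \<open>s + e \<le> (s + 1) * e\<close> lets \<open>e\<close> cancel. What remains rests on
  \<open>b * \<delta> * (\<delta> - 1) * (\<delta> + 1) \<le> K\<close>, the source of the term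
  \<open>b * \<delta> ^ 3 + \<delta>\<close> in the order bound.\<close>

lemma surplus_small:
  fixes b n s t \<delta> K :: nat
  assumes "b \<ge> 1" "n \<ge> order_bound b \<delta>" "s \<ge> 1" "t \<ge> 1" "\<delta> = s + t" "n = K + b * \<delta> + 1"
  shows "s * ((b * s + 1) * (t + 1)) * (s + (b * t * (s - 1) + t)) \<le>
    (b * t * (s - 1) + t) * (K * (K - (t + 1)))"
proof -
  have Keq: "n - b * \<delta> - 1 = K" using assms(6) by simp
  note c = order_bound_consequences[OF assms(1,2), unfolded Keq]
  let ?e = "b * t * (s - 1) + t"
  have "s + ?e \<le> (s + 1) * ?e" using assms(4) by simp
  moreover have "s * ((b * s + 1) * (t + 1)) * (s + 1) \<le> K * (K - (t + 1))"
  proof -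
    have bd: "b * s + 1 \<le> b * \<delta>" using assms(1,4,5) by (simp add: algebra_simps)
    have "s * ((b * s + 1) * (t + 1)) * (s + 1) \<le> (\<delta> - 1) * ((b * \<delta>) * \<delta>) * \<delta>"
      using bd assms(3,4,5) by (intro mult_mono) auto
    also have "\<dots> = (b * \<delta> * (\<delta> - 1) * \<delta>) * \<delta>" by (simp only: mult_ac)
    also have "\<dots> \<le> (b * \<delta> * (\<delta> - 1) * (\<delta> + 1)) * \<delta>" by (intro mult_right_mono mult_left_mono) auto
    also have "\<dots> \<le> K * (K - (t + 1))"
    proof (rule mult_mono)
      have "\<delta> > 0" using assms(4,5) by simp
      then obtain m where m: "\<delta> = Suc m" using gr0_implies_Suc by blast
      show "b * \<delta> * (\<delta> - 1) * (\<delta> + 1) \<le> K"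
        using c(3) by (simp add: m power3_eq_cube algebra_simps)
      show "\<delta> \<le> K - (t + 1)" using c(1) assms(3,5) by simp
    qed auto
    finally show ?thesis .
  qed
  ultimately show ?thesis
  proof -
    assume a: "s + ?e \<le> (s + 1) * ?e" and h: "s * ((b * s + 1) * (t + 1)) * (s + 1) \<le> K * (K - (t + 1))"
    have "s * ((b * s + 1) * (t + 1)) * (s + ?e) \<le> s * ((b * s + 1) * (t + 1)) * ((s + 1) * ?e)"
      using a by (intro mult_left_mono) auto
    also have "\<dots> = ?e * (s * ((b * s + 1) * (t + 1)) * (s + 1))" by (simp only: mult_ac)
    also have "\<dots> \<le> ?e * (K * (K - (t + 1)))" using h by (intro mult_left_mono) auto
    finally show ?thesis .
  qed
qed

section \<open>A lower bound for the spectral radius of the extremal graph\<close>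

text \<open>The equation is \<open>bound\<close> of \<open>join_test_function\<close> with equality,
  for one clique of order \<open>M\<close> and \<open>r\<close> single vertices. At
  \<open>M + s\<close> the clique term alone equals \<open>K - s\<close>, so the single vertices
  make \<open>f\<close> positive; at the total order \<open>M + s + r\<close> it is no longer
  positive.\<close>

lemma extremal_root:
  fixes s r M :: nat
  assumes "s \<ge> 1" "r \<ge> 1" "M \<ge> 1"
  shows "\<exists>K::real. K > M + s \<and> s * (r / (K - 1) + M / (K - M)) = K - s"
proof -
  define f where "f x = real s * (real r / (x - 1) + real M / (x - real M)) - (x - real s)" for x :: real
  let ?a = "real M + real s" and ?b = "real M + real s + real r"
  have "f ?a = s * r / (M + s - 1)" using assms by (simp add: f_def distrib_left)
  also have "\<dots> > 0" using assms by (intro divide_pos_pos) auto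
  finally have fa: "f ?a > 0" .
  have "s * (r / (?b - 1)) \<le> r"
    using assms by (simp add: divide_simps mult.commute)
  moreover have "s * (M / (?b - M)) \<le> M"
    using assms by (simp add: divide_simps)
  ultimately have fb: "f ?b \<le> 0" by (simp add: f_def distrib_left)
  have "continuous_on {?a..?b} f"
    unfolding f_def using assms by (intro continuous_intros) auto
  then have "\<exists>K\<ge>?a. K \<le> ?b \<and> f K = 0" using fa fb by (intro IVT2') auto
  then obtain K where K: "K \<ge> ?a" "f K = 0" by blast
  then have "K \<noteq> ?a" using fa by auto
  then show ?thesis using K by (intro exI[of _ K]) (auto simp: f_def)
qed

lemma extremal_graph_simps:
  "pverts (extremal_graph n b \<delta>) =
     Inl ` {..<\<delta>} \<union> Inr ` (Inl ` {..<n - (b + 1) * \<delta> - 1} \<union> Inr ` {..<b * \<delta> + 1})"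
  "parcs (extremal_graph n b \<delta>) `` {Inl i} =
     (if i < \<delta> then pverts (extremal_graph n b \<delta>) - {Inl i} else {})"
  "parcs (extremal_graph n b \<delta>) `` {Inr (Inl j)} =
     (if j < n - (b + 1) * \<delta> - 1
      then Inl ` {..<\<delta>} \<union> Inr ` Inl ` ({..<n - (b + 1) * \<delta> - 1} - {j}) else {})"
  "parcs (extremal_graph n b \<delta>) `` {Inr (Inr k)} = (if k < b * \<delta> + 1 then Inl ` {..<\<delta>} else {})"
  by (auto simp: extremal_graph_def graph_join_def disjoint_union_def complete_graph_def empty_graph_def
      image_iff map_prod_def split: prod.splits if_splits)

text \<open>The weights are those of \<open>join_test_function\<close> for the partition of the
  extremal graph; \<open>root\<close> is the equation at the \<open>\<delta>\<close> dominating
  vertices. The eigenvalue serves as a lower bound for the spectral radius.\<close>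

lemma extremal_graph_eigenfunction:
  fixes n b \<delta> M r :: nat and K :: real
  defines "M \<equiv> n - (b + 1) * \<delta> - 1" and "r \<equiv> b * \<delta> + 1"
  assumes "K > M" "K > 1" "\<delta> \<ge> 1" and root: "\<delta> * (r / (K - 1) + M / (K - M)) = K - \<delta>"
  shows "\<exists>x. eigenfunction (pverts (extremal_graph n b \<delta>)) (parcs (extremal_graph n b \<delta>)) (K - 1) x"
proof -
  let ?T = "extremal_graph n b \<delta>"
  define x :: "nat + (nat + nat) \<Rightarrow> real" where
    "x v = (case v of Inl _ \<Rightarrow> 1 | Inr (Inl _) \<Rightarrow> \<delta> / (K - M) | Inr (Inr _) \<Rightarrow> \<delta> / (K - 1))" for v
  have V: "pverts ?T = Inl ` {..<\<delta>} \<union> (Inr ` Inl ` {..<M} \<union> Inr ` Inr ` {..<r})"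
    by (simp add: extremal_graph_simps(1) M_def r_def image_Un)
  have sA: "(\<Sum>v\<in>Inl ` A. x v) = card A" for A
    by (subst sum.reindex) (auto simp: x_def)
  have sB: "(\<Sum>v\<in>Inr ` Inl ` A. x v) = card A * (\<delta> / (K - M))" for A
    unfolding image_image by (subst sum.reindex) (auto simp: x_def inj_on_def)
  have sC: "(\<Sum>v\<in>Inr ` Inr ` A. x v) = card A * (\<delta> / (K - 1))" for A
    unfolding image_image by (subst sum.reindex) (auto simp: x_def inj_on_def)
  have "(\<Sum>u\<in>parcs ?T `` {v}. x u) = (K - 1) * x v" if v: "v \<in> pverts ?T" for v
  proof -
    consider i where "v = Inl i" "i < \<delta>" | j where "v = Inr (Inl j)" "j < M" | k where "v = Inr (Inr k)" "k < r"
      using v unfolding V by blast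
    then show ?thesis
    proof cases
      case 1
      have eq: "parcs ?T `` {v} = Inl ` ({..<\<delta>} - {i}) \<union> (Inr ` Inl ` {..<M} \<union> Inr ` Inr ` {..<r})"
        using 1 unfolding extremal_graph_simps(2) V 1 by auto
      have "(\<Sum>u\<in>parcs ?T `` {v}. x u) = (\<Sum>u\<in>Inl ` ({..<\<delta>} - {i}). x u)
          + ((\<Sum>u\<in>Inr ` Inl ` {..<M}. x u) + (\<Sum>u\<in>Inr ` Inr ` {..<r}. x u))"
        unfolding eq by (subst sum.union_disjoint; (subst sum.union_disjoint)?) auto
      also have "\<dots> = \<delta> - 1 + (M * (\<delta> / (K - M)) + r * (\<delta> / (K - 1)))"
        unfolding sA sB sC using 1(2) by (simp add: of_nat_diff)
      also have "\<dots> = \<delta> - 1 + \<delta> * (r / (K - 1) + M / (K - M))" by (simp add: algebra_simps)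
      also have "\<dots> = K - 1" using root assms(5) by (simp add: of_nat_diff)
      finally show ?thesis using 1 by (simp add: x_def)
    next
      case 2
      have eq: "parcs ?T `` {v} = Inl ` {..<\<delta>} \<union> Inr ` Inl ` ({..<M} - {j})"
        using 2 by (simp add: extremal_graph_simps(3) M_def)
      have "(\<Sum>u\<in>parcs ?T `` {v}. x u) = \<delta> + (real M - 1) * (\<delta> / (K - M))"
        unfolding eq by (subst sum.union_disjoint) (use 2(2) in \<open>auto simp: sA sB of_nat_diff\<close>)
      also have "\<dots> = (K - 1) * (\<delta> / (K - M))" using assms(3) by (simp add: field_simps)
      finally show ?thesis using 2 by (simp add: x_def)
    next
      case 3
      then have "parcs ?T `` {v} = Inl ` {..<\<delta>}" by (simp add: extremal_graph_simps(4) r_def)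
      then have "(\<Sum>u\<in>parcs ?T `` {v}. x u) = \<delta>" by (simp add: sA)
      then show ?thesis using 3 assms(4) by (simp add: x_def)
    qed
  qed
  moreover have "Inl 0 \<in> pverts ?T" "x (Inl 0) \<noteq> 0" using assms(5) by (auto simp: V x_def)
  ultimately show ?thesis unfolding eigenfunction_def by blast
qed

section \<open>Graphs without odd factors\<close>

lemma digraph_iso_pairI:
  assumes "pair_graph G" "bij_betw h (pverts G) (pverts T)" "parcs T \<subseteq> pverts T \<times> UNIV"
    and nb: "\<And>v. v \<in> pverts G \<Longrightarrow> h ` (parcs G `` {v}) = parcs T `` {h v}"
  shows "digraph_iso (with_proj G) (with_proj T)"
proof -
  interpret pair_graph G by fact
  define f where "f = \<lparr>iso_verts = h, iso_arcs = map_prod h h, iso_head = snd, iso_tail = fst\<rparr>"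
  have EV: "parcs G \<subseteq> pverts G \<times> pverts G" using in_arcsD1 in_arcsD2 by auto
  have inj: "inj_on h (pverts G)" and img: "h ` pverts G = pverts T"
    using assms(2) by (auto simp: bij_betw_def)
  have "inj_on (map_prod h h) (parcs G)"
    using map_prod_inj_on[OF inj inj] EV by (rule inj_on_subset)
  then have "digraph_isomorphism f"
    using inj wf_digraph by (auto simp: digraph_isomorphism_def f_def)
  moreover have "map_prod h h ` parcs G = parcs T"
  proof (intro equalityI subsetI)
    fix e assume "e \<in> map_prod h h ` parcs G"
    then obtain u v where uv: "e = (h u, h v)" "(u, v) \<in> parcs G" by auto
    then have "h v \<in> parcs T `` {h u}" using nb[of u] EV by blast
    then show "e \<in> parcs T" using uv by simp
  next
    fix e assume e: "e \<in> parcs T"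
    obtain x y where xy: "e = (x, y)" by (cases e)
    then have "x \<in> pverts T" using e assms(3) by auto
    then obtain u where u: "u \<in> pverts G" "x = h u" using img by blast
    then have "y \<in> h ` (parcs G `` {u})" using nb[OF u(1)] e xy by auto
    then show "e \<in> map_prod h h ` parcs G" using u xy by force
  qed
  then have "with_proj T = app_iso f (with_proj G)"
    by (simp add: app_iso_def with_proj_def f_def img)
  ultimately show ?thesis unfolding digraph_iso_def by blast
qed

lemma extremal_graph_iso:
  fixes n b \<delta> :: nat
  defines "M \<equiv> n - (b + 1) * \<delta> - 1"
  assumes G: "pair_graph G" and sub: "S \<subseteq> pverts G" "C \<subseteq> pverts G - S"
    and card: "card S = \<delta>" "card C = M" "card (pverts G - S - C) = b * \<delta> + 1"
    and nbS: "\<And>v. v \<in> S \<Longrightarrow> parcs G `` {v} = pverts G - {v}"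
    and nbC: "\<And>v. v \<in> C \<Longrightarrow> parcs G `` {v} = (C - {v}) \<union> S"
    and nbI: "\<And>v. v \<in> pverts G - S - C \<Longrightarrow> parcs G `` {v} = S"
  shows "digraph_iso (with_proj G) (with_proj (extremal_graph n b \<delta>))"
proof -
  let ?T = "extremal_graph n b \<delta>" and ?V = "pverts G"
  define I where "I = ?V - S - C"
  have finV: "finite ?V" using pair_graph_edges(1)[OF G] .
  have fin: "finite S" "finite C" "finite I"
    using finV sub by (auto simp: I_def intro: finite_subset)
  obtain f where f: "bij_betw f S {..<\<delta>}"
    using fin(1) card(1) by (metis card_lessThan finite_lessThan finite_same_card_bij)
  obtain g where g: "bij_betw g C {..<M}"
    using fin(2) card(2) by (metis card_lessThan finite_lessThan finite_same_card_bij)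
  obtain k where k: "bij_betw k I {..<b * \<delta> + 1}"
    using fin(3) card(3)[folded I_def] by (metis card_lessThan finite_lessThan finite_same_card_bij)
  define h where "h v = (if v \<in> S then Inl (f v) else if v \<in> C then Inr (Inl (g v)) else Inr (Inr (k v)))" for v
  have hS: "h ` A = Inl ` f ` A" if "A \<subseteq> S" for A
    using that by (auto simp: h_def image_iff)
  have hC: "h ` A = Inr ` Inl ` g ` A" if "A \<subseteq> C" for A
    unfolding image_image using that sub by (intro image_cong) (auto simp: h_def)
  have hI: "h ` A = Inr ` Inr ` k ` A" if "A \<subseteq> I" for A
    unfolding image_image using that by (intro image_cong) (auto simp: h_def I_def)
  have imgs: "f ` S = {..<\<delta>}" "g ` C = {..<M}" "k ` I = {..<b * \<delta> + 1}"
    and injs: "inj_on f S" "inj_on g C" "inj_on k I"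
    using f g k by (auto simp: bij_betw_def)
  have V: "?V = S \<union> (C \<union> I)" using sub by (auto simp: I_def)
  have img: "h ` ?V = pverts ?T"
    unfolding V image_Un using hS[of S] hC[of C] hI[of I] imgs
    by (simp add: extremal_graph_simps(1) M_def image_Un)
  have inj: "inj_on h ?V"
  proof (rule inj_onI)
    fix x y assume "x \<in> ?V" "y \<in> ?V" "h x = h y"
    then show "x = y"
      using injs by (auto simp: h_def I_def inj_on_def split: if_splits)
  qed
  have nb: "h ` (parcs G `` {v}) = parcs ?T `` {h v}" if v: "v \<in> ?V" for v
  proof -
    consider "v \<in> S" | "v \<in> C" | "v \<in> I" using v V by blast
    then show ?thesis
    proof cases
      case 1
      then have "f v < \<delta>" using imgs by auto
      then have "parcs ?T `` {h v} = pverts ?T - {h v}"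
        using 1 by (simp add: h_def extremal_graph_simps(2))
      also have "\<dots> = h ` (?V - {v})"
        using inj_on_image_set_diff[OF inj, of ?V "{v}"] v img by simp
      finally show ?thesis using nbS[OF 1] by simp
    next
      case 2
      then have gv: "g v < M" "h v = Inr (Inl (g v))" using imgs sub by (auto simp: h_def)
      have "h ` ((C - {v}) \<union> S) = Inr ` Inl ` g ` (C - {v}) \<union> Inl ` f ` S"
        unfolding image_Un by (subst hC, blast, subst hS, blast, rule refl)
      also have "g ` (C - {v}) = {..<M} - {g v}"
        using inj_on_image_set_diff[OF injs(2), of C "{v}"] 2 imgs by simp
      also have "f ` S = {..<\<delta>}" by (rule imgs)
      finally show ?thesis
        using nbC[OF 2] gv by (simp add: extremal_graph_simps(3) M_def Un_commute)
    next
      case 3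
      then have "k v < b * \<delta> + 1" "h v = Inr (Inr (k v))" using imgs by (auto simp: h_def I_def)
      then show ?thesis
        using nbI[of v] 3 hS[of S] imgs by (simp add: extremal_graph_simps(4) I_def)
    qed
  qed
  have "parcs ?T \<subseteq> pverts ?T \<times> UNIV"
    by (auto simp: extremal_graph_def graph_join_def disjoint_union_def complete_graph_def empty_graph_def)
  then show ?thesis
    using digraph_iso_pairI[OF G _ _ nb] inj img by (auto simp: bij_betw_def)
qed

section \<open>From a missing factor to a partition with few clique orders\<close>

text \<open>The leftover vertices are added as a part, if there are any, so that the parts cover
  \<open>V - S\<close>. If the odd pieces exceed \<open>b * card S\<close> by only one, parity makes
  the leftover set odd, hence nonempty, and it is the missing part.\<close>

lemma barrier_partition:
  assumes "finite V" "E \<subseteq> V \<times> V" "sym E" "odd b" "even (card V)"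
    and "\<not> barrier_free E V (\<lambda>_. b)"
  shows "\<exists>S P. S \<subseteq> V \<and> pairwise disjnt P \<and> \<Union>P = V - S \<and> {} \<notin> P \<and>
    (\<forall>C\<in>P. E `` C \<subseteq> C \<union> S) \<and> b * card S + 2 \<le> card P"
proof -
  let ?f = "\<lambda>_. b"
  obtain S P where SP: "S \<subseteq> V" "odd_pieces E V ?f S P" "card P > b * card S"
    using assms(6) by (auto simp: barrier_free_def not_le mult.commute)
  define R where "R = V - S - \<Union>P"
  have finP: "finite P" using odd_pieces_finite[OF assms(1) SP(2)] .
  have P: "pairwise disjnt P" "{} \<notin> P" "\<And>C. C \<in> P \<Longrightarrow> C \<subseteq> V - S" "\<And>C. C \<in> P \<Longrightarrow> E `` C \<subseteq> C \<union> S"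
    using SP(2) by (auto simp: odd_pieces_def)
  have "E `` R \<subseteq> R \<union> S"
  proof
    fix y assume "y \<in> E `` R"
    then obtain x where x: "x \<in> R" "(x, y) \<in> E" by auto
    then have "(y, x) \<in> E" "y \<in> V" using assms(2,3) by (auto dest: symD)
    then show "y \<in> R \<union> S" using x P(4) unfolding R_def by blast
  qed
  moreover have disj: "disjnt R C" if "C \<in> P" for C using that by (auto simp: R_def disjnt_def)
  moreover have "b * card S + 2 \<le> card (if R = {} then P else insert R P)"
  proof (cases "card P = b * card S + 1")
    case True
    have "odd (card P + sum ?f S)" "even (sum ?f V)" using True assms(5) by (simp_all add: mult.commute)
    note odd_pieces_insert_rest[OF assms(1-3) SP(1,2) this(2,1), folded R_def]
    then show ?thesis using True finP by (auto simp: odd_pieces_def)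
  next
    case False
    then have "b * card S + 2 \<le> card P" using SP(3) by simp
    also have "\<dots> \<le> card (if R = {} then P else insert R P)" using finP by (simp add: card_insert_le)
    finally show ?thesis .
  qed
  moreover have "pairwise disjnt (if R = {} then P else insert R P)"
    using P(1) disj by (auto simp: pairwise_insert disjnt_sym)
  moreover have "\<Union>(if R = {} then P else insert R P) = V - S" using P(3) by (auto simp: R_def)
  ultimately show ?thesis
    using SP(1) P(2,4) by (intro exI[of _ S] exI[of _ "if R = {} then P else insert R P"]) auto
qed

text \<open>For odd \<open>b\<close> the parity condition says that degrees are odd, which also
  yields the lower bound 1.\<close>

lemma odd_factor_of_barrier_free:
  assumes "pair_graph G" "odd b" "barrier_free (parcs G) (pverts G) (\<lambda>_. b)"
  shows "\<exists>H. odd_factor b G H"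
proof -
  note g = pair_graph_edges[OF assms(1)]
  obtain H where H: "H \<subseteq> parcs G" "sym H"
    "\<And>v. v \<in> pverts G \<Longrightarrow> card (H `` {v}) \<le> b \<and> even (card (H `` {v}) + b)"
    using parity_factor[OF g assms(3)] by blast
  let ?H = "\<lparr>pverts = pverts G, parcs = H\<rparr>"
  have pH: "pair_graph ?H" 
    using g H(1,2) by (intro pair_graphI) (auto simp: irrefl_def)
  have "wf_digraph (with_proj G)" "wf_digraph (with_proj ?H)"
    using assms(1) pH by (auto simp: wf_digraph_wp_iff pair_graph_def pair_digraph_def pair_fin_digraph_def)
  then have "spanning (with_proj ?H) (with_proj G)"
    using H(1) by (auto simp: spanning_def subgraph_def compatible_def)
  moreover have "odd (degree_of ?H v) \<and> 1 \<le> degree_of ?H v \<and> degree_of ?H v \<le> b" if "v \<in> pverts G" for v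
  proof -
    have "odd (card (H `` {v}))" using H(3)[OF that] assms(2) by simp
    moreover from this have "card (H `` {v}) \<noteq> 0" by (metis even_zero)
    ultimately show ?thesis using H(3)[OF that] by (simp add: degree_of_eq)
  qed
  ultimately show ?thesis using pH by (auto simp: odd_factor_def)
qed

text \<open>If all parts had order 1, the total would be \<open>r + 1 < M + r\<close>; once a part
  of order \<open>M\<close> is set aside, the other \<open>r\<close> nonempty parts share
  \<open>r\<close> vertices.\<close>

lemma one_large_part:
  fixes M r :: nat
  assumes "finite P" "card P = r + 1" "M > 1" "(\<Sum>C\<in>P. card C) = M + r"
    and "\<And>C. C \<in> P \<Longrightarrow> card C = 1 \<or> card C = M"
  obtains C where "C \<in> P" "card C = M" "\<And>D. D \<in> P \<Longrightarrow> D \<noteq> C \<Longrightarrow> card D = 1"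
proof -
  have "\<exists>C\<in>P. card C = M"
  proof (rule ccontr)
    assume "\<not> ?thesis"
    then have "(\<Sum>C\<in>P. card C) = (\<Sum>C\<in>P. 1)" using assms(5) by (intro sum.cong) auto
    then show False using assms(2-4) by simp
  qed
  then obtain C where C: "C \<in> P" "card C = M" by blast
  have "(\<Sum>D\<in>P - {C}. 1) = (\<Sum>D\<in>P - {C}. card D)"
    using assms(1,2,4) C by (simp add: sum.remove)
  moreover have "1 \<le> card D" if "D \<in> P - {C}" for D using assms(3,5) that by fastforce
  ultimately have "card D = 1" if "D \<in> P - {C}" for D
    using sum_mono_inv[of "\<lambda>_. 1" "P - {C}" card D] assms(1) that by simp
  then show ?thesis using that C by auto
qed

theorem theorem1p2:
  fixes G :: "'a pair_pre_digraph" and b n \<delta> :: nat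
  assumes "b > 0" and "odd b"
    and "pair_graph G"
    and "Digraph_Component.connected (with_proj G)"
    and "card (pverts G) = n" and "even n"
    and "min_degree G = \<delta>"
    and "n \<ge> order_bound b \<delta>"
    and "graph_spectral_radius G \<ge> graph_spectral_radius (extremal_graph n b \<delta>)"
    and "\<not> digraph_iso (with_proj G) (with_proj (extremal_graph n b \<delta>))"
  shows "\<exists>H. odd_factor b G H"
proof (rule ccontr)
  assume no_factor: "\<not> ?thesis"
  let ?V = "pverts G" and ?E = "parcs G" and ?T = "extremal_graph n b \<delta>"
  note g = pair_graph_edges[OF assms(3)]
  note conn = connected_closed[OF assms(3,4)]
  have b1: "b \<ge> 1" using assms(1) by simp
  have n4: "n \<ge> 4" using assms(8) by (simp add: order_bound_def)
  have Vne: "?V \<noteq> {}" using n4 assms(5) by auto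
  have deg: "\<delta> \<le> card (?E `` {v})" if "v \<in> ?V" for v
    using assms(7) g(1) that by (auto simp: min_degree_def degree_of_eq)
  have finE: "finite (?E `` A)" for A using g(1,2) by (auto intro: finite_subset[of _ ?V])
  have \<delta>1: "\<delta> \<ge> 1"
  proof (rule ccontr)
    assume "\<not> \<delta> \<ge> 1"
    moreover have "\<delta> \<in> degree_of G ` ?V"
      using assms(7) g(1) Vne unfolding min_degree_def by (metis Min_in finite_imageI image_is_empty)
    ultimately obtain v where "v \<in> ?V" "card (?E `` {v}) = 0" by (auto simp: degree_of_eq)
    then have "?E `` {v} = {}" using finE by simp
    then have "?V = {v}" using conn[of "{v}"] \<open>v \<in> ?V\<close> by simp
    then have "n = 1" using assms(5) by simp
    then show False using n4 by simp
  qed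
  have "\<not> barrier_free ?E ?V (\<lambda>_. b)"
    using odd_factor_of_barrier_free[OF assms(3,2)] no_factor by blast
  then obtain S P where S: "S \<subseteq> ?V" and P: "pairwise disjnt P" "\<Union>P = ?V - S" "{} \<notin> P"
      "\<And>C. C \<in> P \<Longrightarrow> ?E `` C \<subseteq> C \<union> S" and cP: "b * card S + 2 \<le> card P"
    using barrier_partition[OF g(1-3) assms(2)] assms(5,6) by blast
  have nbP: "\<forall>C\<in>P. ?E `` C \<subseteq> C \<union> S" using P(4) by blast
  define s where "s = card S"
  have finP: "finite P" using cP by (intro card_ge_0_finite) simp
  have finS: "finite S" using S g(1) finite_subset by blast
  have CV: "C \<subseteq> ?V - S" if "C \<in> P" for C using P(2) that by blast
  have finC: "finite C" if "C \<in> P" for C using CV[OF that] g(1) finite_subset by blast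
  \<comment> \<open>With \<open>S\<close> empty each part would be closed, hence all of
    \<open>V\<close>, but there are at least two parts.\<close>
  have Sne: "S \<noteq> {}"
  proof
    assume S0: "S = {}"
    have "C = ?V" if "C \<in> P" for C
      using conn[of C] CV[OF that] P(3) P(4)[OF that] that S0 by auto
    then have "P \<subseteq> {?V}" by auto
    then have "card P \<le> 1" using card_mono[of "{?V}" P] by simp
    then show False using cP by simp
  qed
  have s1: "s \<ge> 1" using Sne finS by (simp add: s_def Suc_leI card_gt_0_iff)
  have "card (?V - S) = n - s" "s \<le> n"
    using S finS assms(5) card_mono[OF g(1) S] by (simp_all add: s_def card_Diff_subset)
  moreover have "card (\<Union>P) = (\<Sum>C\<in>P. card C)"
    using P(1) finC by (intro card_Union_disjoint) auto
  ultimately have total: "(\<Sum>C\<in>P. card C) + s = n" using P(2) by simp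
  then have total_real: "(\<Sum>C\<in>P. real (card C)) = real n - real s"
    by (metis add_diff_cancel_right' of_nat_add of_nat_sum)
  have part_ge: "\<delta> + 1 \<le> card C + s" if C: "C \<in> P" for C
  proof -
    obtain v where v: "v \<in> C" using P(3) C by (metis all_not_in_conv)
    have "?E `` {v} \<subseteq> (C - {v}) \<union> S" using P(4)[OF C] v g(4) by (auto simp: irrefl_def)
    then have "card (?E `` {v}) \<le> card ((C - {v}) \<union> S)" using finC[OF C] finS by (intro card_mono) auto
    also have "\<dots> \<le> card (C - {v}) + card S" by (rule card_Un_le)
    also have "\<dots> + 1 = card C + s" using v finC[OF C] card_Suc_Diff1[of C v] by (simp add: s_def)
    finally show ?thesis using deg[of v] v CV[OF C] by auto
  qed
  have part_pos: "1 \<le> card C" if "C \<in> P" for C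
  proof -
    have "C \<noteq> {}" using P(3) that by blast
    then show ?thesis using finC[OF that] by (simp add: Suc_leI card_gt_0_iff)
  qed
  define K where "K = n - b * \<delta> - 1"
  have ob: "K \<ge> 7 * \<delta> + 3" "n = K + b * \<delta> + 1"
    unfolding K_def by (rule order_bound_consequences[OF b1 assms(8)])+
  define M where "M = n - (b + 1) * \<delta> - 1"
  have MK: "K = M + \<delta>" "M > 1" "n = M + \<delta> + (b * \<delta> + 1)"
  proof -
    have "(b + 1) * \<delta> = b * \<delta> + \<delta>" by simp
    then show "K = M + \<delta>" "M > 1" "n = M + \<delta> + (b * \<delta> + 1)"
      using ob(1,2) unfolding M_def by linarith+
  qed
  obtain L :: real where L: "L > M + \<delta>" "\<delta> * (real (b * \<delta> + 1) / (L - 1) + M / (L - M)) = L - \<delta>"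
    using extremal_root[of \<delta> "b * \<delta> + 1" M] \<delta>1 MK(2) by auto
  have LK: "L > K" using L(1) MK by simp
  have "finite (pverts ?T)" "parcs ?T \<subseteq> pverts ?T \<times> pverts ?T"
    by (auto simp: extremal_graph_def graph_join_def disjoint_union_def complete_graph_def empty_graph_def)
  moreover have "\<exists>x. eigenfunction (pverts ?T) (parcs ?T) (L - 1) x"
    by (rule extremal_graph_eigenfunction[of n b \<delta> L, folded M_def]) (use L MK(2) \<delta>1 in simp_all)
  ultimately have "L - 1 \<le> graph_spectral_radius ?T" using graph_spectral_radius_ge by blast
  then have rho: "L - 1 \<le> graph_spectral_radius G" using assms(9) by simp
  obtain x where x: "eigenfunction ?V ?E (graph_spectral_radius G) x"
    using graph_spectral_radius_eigenfunction[OF g(1,2,3) Vne] by blast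
  \<comment> \<open>Common to \<open>s > \<delta>\<close> and \<open>s < \<delta>\<close>:
    \<open>p\<close> bounds the part orders from below and \<open>e\<close> is the shortfall of the
    largest clique against \<open>K\<close>. The test function then gives spectral radius at most
    \<open>K - 1\<close>, below \<open>L - 1\<close>.\<close>
  have surplus: False
    if p: "\<And>C. C \<in> P \<Longrightarrow> p \<le> card C" "p \<ge> 1" and e: "e \<ge> 1" "n + e = K + (b * s + 1) * p"
      and ineq: "s * ((b * s + 1) * p) * (s + e) \<le> e * (K * (K - p))" for p e :: nat
  proof -
    have "(b * s + 2) * p \<le> card P * p" using cP[folded s_def] by (rule mult_right_mono) simp
    also have "\<dots> \<le> (\<Sum>C\<in>P. card C)" using sum_bounded_below[of P p card] p(1) by simp
    finally have "(b * s + 2) * p + s \<le> n" using total by simp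
    moreover have "(b * s + 2) * p = (b * s + 1) * p + p" by (simp add: algebra_simps)
    ultimately have le_n: "p + (b * s + 1) * p + s \<le> n" by linarith
    \<comment> \<open>The order of the one large part in the extreme distribution, whose other
      \<open>b * s + 1\<close> parts have order \<open>p\<close>.\<close>
    define m where "m = n - (b * s + 1) * p - s"
    have m: "n = m + (b * s + 1) * p + s" "p \<le> m" using le_n unfolding m_def by linarith+
    have K: "K = m + s + e" using e(2) m(1) by simp
    have pK: "p < K" using K m(2) s1 by simp
    have mK: "m < K" using K s1 by simp
    note q = sum_quotient_le_extreme[of P "b * s + 2" "real p" "real m" "real K" "\<lambda>C. real (card C)"]
    have qt: "(\<Sum>C\<in>P. real (card C)) = real m + (real (b * s + 2) - 1) * real p"
      using total_real m(1) by (simp add: algebra_simps)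
    have prems: "finite P" "1 \<le> b * s + 2" "b * s + 2 \<le> card P" "0 < real p" "real p \<le> real m"
        "real m < real K" "\<And>C. C \<in> P \<Longrightarrow> real p \<le> real (card C)"
      using finP cP p m(2) mK by (simp_all add: s_def)
    have "real (s * ((b * s + 1) * p) * (s + e)) \<le> real (e * (K * (K - p)))"
      using ineq by (simp only: of_nat_le_iff)
    then have ineq': "real s * (real (b * s + 1) * real p) * (real s + real e) \<le> real e * (real K * (real K - real p))"
      by (simp only: of_nat_mult of_nat_add of_nat_diff[OF less_imp_le[OF pK]])
    have "s * (\<Sum>C\<in>P. card C / (real K - card C)) \<le>
        s * ((real (b * s + 2) - 1) * p / (real K - p) + m / (real K - m))"
      by (rule mult_left_mono[OF q(2)[OF prems qt] of_nat_0_le_iff])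
    also have "real (b * s + 2) - 1 = real (b * s + 1)" by simp
    also have "s * (real (b * s + 1) * p / (real K - p) + m / (real K - m)) \<le> real K - s"
      using extremal_bound_of_surplus[of "real K" "real m" "real s" "real e" "real p" "real (b * s + 1)"]
        K s1 e(1) pK ineq' by simp
    finally have bound: "card S * (\<Sum>C\<in>P. card C / (real K - card C)) \<le> real K - card S"
      by (simp add: s_def)
    have "\<forall>C\<in>P. real (card C) < real K"
      using q(1)[OF prems qt] prems(6) by (meson le_less_trans)
    from join_test_function[OF g(1,2,4) S Sne P(1,2) nbP this bound]
    obtain z where z: "\<forall>v\<in>?V. z v > 0" "\<forall>v\<in>?V. (\<Sum>u\<in>?E `` {v}. z u) \<le> (real K - 1) * z v"
      by (elim exE conjE)
    have "graph_spectral_radius G \<le> real K - 1"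
      by (rule eigenvalue_le[OF g(1-3) x]) (use z in blast)+
    then show False using rho LK by simp
  qed
  consider "s > \<delta>" | "s < \<delta>" | "s = \<delta>" by linarith
  then show False
  proof cases
    case 1
    define d where "d = s - \<delta>"
    have d: "d \<ge> 1" "s = \<delta> + d" using 1 by (auto simp: d_def)
    have "card P \<le> (\<Sum>C\<in>P. card C)" using sum_bounded_below[of P 1 card] part_pos by simp
    then have n: "n \<ge> (b + 1) * s + 2" using cP total by (simp add: s_def)
    show False
    proof (rule surplus[of 1 "b * d"])
      show "1 \<le> b * d" using b1 d(1) by simp
      show "n + b * d = K + (b * s + 1) * 1" using ob(2) d(2) by (simp add: algebra_simps)
      show "s * ((b * s + 1) * 1) * (s + b * d) \<le> b * d * (K * (K - 1))"
        using surplus_large[OF b1 assms(8) d n ob(2)] by simp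
    qed (use part_pos in auto)
  next
    case 2
    define t where "t = \<delta> - s"
    have t: "t \<ge> 1" "\<delta> = s + t" using 2 by (auto simp: t_def)
    obtain s' where s': "s = Suc s'" using s1 by (cases s) auto
    show False
    proof (rule surplus[of "t + 1" "b * t * (s - 1) + t"])
      show "t + 1 \<le> card C" if "C \<in> P" for C using part_ge[OF that] t by simp
      show "1 \<le> b * t * (s - 1) + t" using t by simp
      show "n + (b * t * (s - 1) + t) = K + (b * s + 1) * (t + 1)"
        using ob(2) t(2) s' by (simp add: algebra_simps)
      show "s * ((b * s + 1) * (t + 1)) * (s + (b * t * (s - 1) + t))
          \<le> (b * t * (s - 1) + t) * (K * (K - (t + 1)))"
        by (rule surplus_small[OF b1 assms(8) s1 t ob(2)])
    qed simp
  next
    case 3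
    note q = sum_quotient_le_extreme[of P "b * \<delta> + 2" 1 "real M" L "\<lambda>C. real (card C)"]
    have qt: "(\<Sum>C\<in>P. real (card C)) = real M + (real (b * \<delta> + 2) - 1) * 1"
      using total_real MK(3) 3 by simp
    have prems: "finite P" "1 \<le> b * \<delta> + 2" "b * \<delta> + 2 \<le> card P" "0 < (1::real)" "1 \<le> real M" "real M < L"
        "\<And>C. C \<in> P \<Longrightarrow> 1 \<le> real (card C)"
      using finP cP 3 MK(2) L(1) part_pos by (auto simp: s_def)
    have val: "\<delta> * ((real (b * \<delta> + 2) - 1) * 1 / (L - 1) + M / (L - M)) = L - \<delta>"
      using L(2) by simp
    have "\<delta> * (\<Sum>C\<in>P. card C / (L - card C)) \<le> L - \<delta>"
      using mult_left_mono[OF q(2)[OF prems qt], of "real \<delta>"] val by simp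
    then have bound: "card S * (\<Sum>C\<in>P. card C / (L - card C)) \<le> L - card S"
      using 3 by (simp add: s_def)
    have "\<forall>C\<in>P. real (card C) < L"
      using q(1)[OF prems qt] prems(6) by (meson le_less_trans)
    from join_test_function[OF g(1,2,4) S Sne P(1,2) nbP this bound]
    obtain z where z: "\<forall>v\<in>?V. z v > 0" "\<forall>v\<in>?V. (\<Sum>u\<in>?E `` {v}. z u) \<le> (L - 1) * z v"
      and full: "(\<forall>v\<in>?V. (\<Sum>u\<in>?E `` {v}. z u) = (L - 1) * z v) \<Longrightarrow>
       card S * (\<Sum>C\<in>P. card C / (L - card C)) = L - card S \<and>
       (\<forall>v\<in>S. ?E `` {v} = ?V - {v}) \<and> (\<forall>C\<in>P. \<forall>v\<in>C. ?E `` {v} = (C - {v}) \<union> S)"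
      by (elim exE conjE) (rule that; assumption?; blast)
    have "graph_spectral_radius G \<le> L - 1"
      by (rule eigenvalue_le[OF g(1-3) x]) (use z in blast)+
    \<comment> \<open>The chain \<open>L - 1 \<le> \<rho>(T) \<le> \<rho>(G) \<le> L - 1\<close>
      collapses, so the test function is an eigenfunction of \<open>G\<close> and all estimates
      behind it are equalities.\<close>
    then have rho_eq: "graph_spectral_radius G = L - 1" using rho by simp
    have "(\<Sum>u\<in>?E `` {v}. z u) = (L - 1) * z v" if "v \<in> ?V" for v
      by (rule eigenvalue_eq[OF g(1-3) x _ _ rho_eq conn that]) (use z in blast)+
    then have "\<forall>v\<in>?V. (\<Sum>u\<in>?E `` {v}. z u) = (L - 1) * z v" by blast
    note full = full[OF this]
    have "\<delta> * (\<Sum>C\<in>P. card C / (L - card C)) =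
        \<delta> * ((real (b * \<delta> + 2) - 1) * 1 / (L - 1) + M / (L - M))"
      using full val 3 by (simp add: s_def)
    then have "(\<Sum>C\<in>P. card C / (L - card C)) = (real (b * \<delta> + 2) - 1) * 1 / (L - 1) + M / (L - M)"
      using \<delta>1 by simp
    \<comment> \<open>Equality in the convexity estimate leaves \<open>b * \<delta> + 2\<close>
      parts of orders 1 and \<open>M\<close>; equality of neighbourhoods has already filled in all
      edges of the join.\<close>
    from q(3)[OF prems qt this]
    have shape: "card P = b * \<delta> + 2" "\<And>C. C \<in> P \<Longrightarrow> card C = 1 \<or> card C = M" by auto
    have "(\<Sum>C\<in>P. card C) = M + (b * \<delta> + 1)" using total MK(3) 3 by simp
    then obtain C where C: "C \<in> P" "card C = M" "\<And>D. D \<in> P \<Longrightarrow> D \<noteq> C \<Longrightarrow> card D = 1"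
      using one_large_part[of P "b * \<delta> + 1" M] finP shape MK(2) by auto
    have "digraph_iso (with_proj G) (with_proj ?T)"
    proof (rule extremal_graph_iso[OF assms(3) S CV[OF C(1)]])
      show "card S = \<delta>" using 3 by (simp add: s_def)
      show "card C = n - (b + 1) * \<delta> - 1" using C(2) by (simp add: M_def)
      show "card (?V - S - C) = b * \<delta> + 1"
        using \<open>card (?V - S) = n - s\<close> CV[OF C(1)] finC[OF C(1)] C(2) MK(3) 3 by (simp add: card_Diff_subset)
      show "?E `` {v} = ?V - {v}" if "v \<in> S" for v using full that by blast
      show "?E `` {v} = (C - {v}) \<union> S" if "v \<in> C" for v using full C(1) that by blast
      show "?E `` {v} = S" if v: "v \<in> ?V - S - C" for v
      proof -
        obtain D where D: "D \<in> P" "v \<in> D" using v P(2) by blast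
        then have "card D = 1" using C(3) v by blast
        then have "D = {v}" using D(2) by (auto simp: card_1_singleton_iff)
        moreover have "?E `` {v} = (D - {v}) \<union> S" using full D by blast
        ultimately show ?thesis by simp
      qed
    qed
    then show False using assms(10) by simp
  qed
qed

end
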